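(* For each integer $t\ge4$, write $t=2^p+m$ with integers $p\ge0$, $0<m\le2^p$ (so $p=p(t)$, $m=m(t)$), and for $2\le k\le m$ set $a=\lceil(t+2k+1)/3\rceil$, $b=\lfloor t/2\rfloor+k-1$. Let $B_t$ be the set of the three-forms $$\sum_{r=a}^{b}\sum_{s=0}^{p-1}\binom{m-k}{t-r-2^s}F(e^{t+2k-2r,\,r},e^r)=\sum_{r=a}^{b}\sum_{s=0}^{p-1}\binom{m-k}{t-r-2^s}\sum_{l\ge0}D^l(e^{t+2k-2r}\wedge e^r)\wedge e^{r+l+1},\qquad 2\le k\le m,$$ where the binomial coefficients are taken modulo $2$; the elements of $B_t$ lie in $\Lambda^3(\mathfrak{m}_0(t))$. Then for every $n\ge4$, the cohomology classes of the elements of the set $$\{e^{1,i-1,i}\;:\;2+\lfloor n/2\rfloor\le i\le n\}\cup\bigcup_{4\le t\le n}B_t$$ form a basis of the cohomology space $H^3(\mathfrak{m}_0(n))$ over the field $\mathbb{Z}_2$.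
   Context: All vector spaces are over $\mathbb{Z}_2$. $\mathfrak{m}_0$ is the Lie algebra with basis $e_1,e_2,\dots$ and $[e_1,e_i]=e_{i+1}$ for $i\ge2$; $\mathfrak{m}_0(n)$ is the Lie algebra with basis $e_1,\dots,e_n$ and $[e_1,e_i]=e_{i+1}$ for $2\le i\le n-1$ (other brackets of basis elements not following by antisymmetry are zero). Let $e^i$ be the dual basis elements and write $e^{i_1i_2\dots i_q}=e^{i_1}\wedge\dots\wedge e^{i_q}$. $\Lambda^q(\mathfrak{m}_0(n))$ is the span of the monomials $e^{i_1\dots i_q}$ with $1\le i_j\le n$, viewed inside the space of all finite linear combinations of monomials $e^{i_1\dots i_q}$, $i_j\ge1$. The differential $d$ on $\Lambda(\mathfrak{m}_0(n))$ is the derivation with $de^1=de^2=0$, $de^i=e^1\wedge e^{i-1}$ for $i\ge3$, and $H^q(\mathfrak{m}_0(n))=\ker(d:\Lambda^q\to\Lambda^{q+1})/\mathrm{Im}(d:\Lambda^{q-1}\to\Lambda^q)$. $D$ is the derivation of the exterior algebra generated by $e^2,e^3,\dots$ with $De^2=0$ and $De^i=e^{i-1}$ for $i>2$ (so that $d\omega=e^1\wedge D\omega$ on this algebra); $D^0=\mathrm{id}$. For $\omega$ in this algebra and $i\ge2$, $F(\omega,e^i)=\sum_{l\ge0}D^l\omega\wedge e^{i+1+l}$ (a finite sum). Convention: $\binom{N}{t}=0$ if $t<0$ or $t>N$. *)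

theory Defs
  imports "HOL-Library.Z2" "HOL-Library.Poly_Mapping" "Jordan_Normal_Form.VS_Connect"
begin

section \<open>The exterior algebra over the two-element field\<close>

text \<open>
  Over \<^typ>\<open>bit\<close> signs play no role, so a wedge product of generators with distinct indices
  is determined by its set of indices, and a form is a finitely supported function on sets of
  indices.  Only finite sets of positive indices occur below.
\<close>

type_synonym form = "nat set \<Rightarrow>\<^sub>0 bit"

definition scale :: "bit \<Rightarrow> form \<Rightarrow> form" where
  "scale c w = Poly_Mapping.map ((*) c) w"

definition wedge :: "form \<Rightarrow> form \<Rightarrow> form" (infixr \<open>\<and>\<^sub>f\<close> 70) where
  "v \<and>\<^sub>f w = (\<Sum>A\<in>Poly_Mapping.keys v. \<Sum>B\<in>Poly_Mapping.keys w.
     if A \<inter> B = {} then Poly_Mapping.single (A \<union> B) (Poly_Mapping.lookup v A * Poly_Mapping.lookup w B)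
     else 0)"

text \<open>\<open>e_mon [i\<^sub>1, \<dots>, i\<^sub>q]\<close> is the wedge product of the generators with these indices, in this order; it
  vanishes if an index is repeated.\<close>

definition e_mon :: "nat list \<Rightarrow> form" where
  "e_mon is = foldr (\<lambda>i w. Poly_Mapping.single {i} 1 \<and>\<^sub>f w) is (Poly_Mapping.single {} 1)"

text \<open>
  The derivation with prescribed values \<open>g i\<close> on the generators \<open>e\<^sup>i\<close>: on a monomial, each
  factor \<open>e\<^sup>i\<close> in turn is replaced by \<open>g i\<close>, and this is extended linearly; see
  \<open>derivation_generator\<close> and \<open>derivation_wedge\<close> below.
\<close>

definition derivation :: "(nat \<Rightarrow> form) \<Rightarrow> form \<Rightarrow> form" where
  "derivation g w = (\<Sum>A\<in>Poly_Mapping.keys w. \<Sum>i\<in>A.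
     scale (Poly_Mapping.lookup w A) (g i \<and>\<^sub>f Poly_Mapping.single (A - {i}) 1))"

definition d_op :: "form \<Rightarrow> form" where
  "d_op = derivation (\<lambda>i. if i \<le> 2 then 0 else e_mon [1, i - 1])"

definition D_op :: "form \<Rightarrow> form" where
  "D_op = derivation (\<lambda>i. if i \<le> 2 then 0 else e_mon [i - 1])"

text \<open>The sum over all \<open>l\<close> has finite support, see \<open>finite_support_F\<close> below.\<close>

definition F_op :: "form \<Rightarrow> nat \<Rightarrow> form" where
  "F_op w i = Sum_any (\<lambda>l. (D_op ^^ l) w \<and>\<^sub>f e_mon [i + 1 + l])"


section \<open>The cohomology of \<open>m\<^sub>0(n)\<close>\<close>

definition Lam :: "nat \<Rightarrow> nat \<Rightarrow> form set" where
  "Lam n q = {w. \<forall>A\<in>Poly_Mapping.keys w. A \<subseteq> {1..n} \<and> card A = q}"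

definition cocycles :: "nat \<Rightarrow> nat \<Rightarrow> form set" where
  "cocycles n q = {w \<in> Lam n q. d_op w = 0}"

definition coboundaries :: "nat \<Rightarrow> nat \<Rightarrow> form set" where
  "coboundaries n q = (if q = 0 then {0} else d_op ` Lam n (q - 1))"

definition coh_class :: "nat \<Rightarrow> nat \<Rightarrow> form \<Rightarrow> form set" where
  "coh_class n q z = (+) z ` coboundaries n q"

text \<open>
  The quotient space of cocycles by coboundaries, as a module record over \<open>class_ring\<close>;
  the ring multiplication and unit of the record are irrelevant.
\<close>

definition cohomology :: "nat \<Rightarrow> nat \<Rightarrow> (bit, form set) module" where
  "cohomology n q =
     \<lparr>carrier = coh_class n q ` cocycles n q,
      mult = undefined,
      one = undefined,
      zero = coboundaries n q,
      add = (\<lambda>X Y. {x + y | x y. x \<in> X \<and> y \<in> Y}),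
      smult = (\<lambda>c X. {scale c x + b | x b. x \<in> X \<and> b \<in> coboundaries n q})\<rparr>"


section \<open>The three-forms\<close>

definition binom :: "nat \<Rightarrow> int \<Rightarrow> nat" where
  "binom N t = (if t < 0 then 0 else N choose (nat t))"

text \<open>
  Here \<open>t = 2\<^sup>p + m\<close>.  In the range of \<open>r\<close> one has \<open>2 \<le> t + 2 * k - 2 * r < r\<close>, so the
  subtraction of natural numbers in the first index does not truncate.
\<close>

definition B_form :: "nat \<Rightarrow> nat \<Rightarrow> nat \<Rightarrow> nat \<Rightarrow> form" where
  "B_form t p m k =
     (\<Sum>r = nat \<lceil>real (t + 2 * k + 1) / 3\<rceil>..t div 2 + k - 1. \<Sum>s<p.
        scale (of_nat (binom (m - k) (int t - int r - 2 ^ s))) (F_op (e_mon [t + 2 * k - 2 * r, r]) r))"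

text \<open>The pair \<open>(p, m)\<close> is determined by \<open>t\<close>, see \<open>ex1_pm\<close> below.\<close>

definition B_set :: "nat \<Rightarrow> form set" where
  "B_set t = {B_form t p m k | p m k. t = 2 ^ p + m \<and> 0 < m \<and> m \<le> 2 ^ p \<and> 2 \<le> k \<and> k \<le> m}"

definition generators :: "nat \<Rightarrow> form set" where
  "generators n = {e_mon [1, i - 1, i] | i. 2 + n div 2 \<le> i \<and> i \<le> n} \<union> (\<Union>t\<in>{4..n}. B_set t)"


section \<open>Basic facts justifying the definitions\<close>

lemma bit_neq_0: "(x::bit) \<noteq> 0 \<longleftrightarrow> x = 1"
  by (cases x) auto

lemma form_double: "(w::form) + w = 0"
  by (rule poly_mapping_eqI) (simp add: lookup_add)

lemma form_cancel [simp]: "w + (w + v) = (v::form)"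
  by (simp add: add.assoc[symmetric] form_double)

lemma lookup_scale: "Poly_Mapping.lookup (scale c w) A = c * Poly_Mapping.lookup w A"
  unfolding scale_def by transfer (simp add: when_def)

lemma scale_simps [simp]: "scale 0 w = 0" "scale 1 w = w"
  by (simp_all add: poly_mapping_eq_iff fun_eq_iff lookup_scale)

lemma scale_zero [simp]: "scale c 0 = 0"
  by (cases c) auto

lemma scale_add: "scale c (v + w) = scale c v + scale c w"
  by (cases c) auto

lemma scale_add_left: "scale (b + c) w = scale b w + scale c w"
  by (cases b; cases c) (auto simp: form_double)

lemma scale_scale: "scale (b * c) w = scale b (scale c w)"
  by (cases b; cases c) auto

abbreviation mon :: "nat set \<Rightarrow> form" where
  "mon A \<equiv> Poly_Mapping.single A 1"

lemma lookup_key: "A \<in> Poly_Mapping.keys (w::form) \<Longrightarrow> Poly_Mapping.lookup w A = 1"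
  by (simp add: in_keys_iff bit_neq_0)

lemma wedge_eq:
  "v \<and>\<^sub>f w = (\<Sum>A\<in>Poly_Mapping.keys v. \<Sum>B\<in>Poly_Mapping.keys w. if A \<inter> B = {} then mon (A \<union> B) else 0)"
  unfolding wedge_def by (intro sum.cong refl) (simp add: lookup_key)

lemma derivation_eq:
  "derivation g w = (\<Sum>A\<in>Poly_Mapping.keys w. \<Sum>i\<in>A. g i \<and>\<^sub>f mon (A - {i}))"
  unfolding derivation_def by (intro sum.cong refl) (simp add: lookup_key)

lemma form_sum_mon: "w = (\<Sum>A\<in>Poly_Mapping.keys w. mon A)" for w :: form
proof (rule poly_mapping_eqI)
  fix A
  show "Poly_Mapping.lookup w A = Poly_Mapping.lookup (\<Sum>A\<in>Poly_Mapping.keys w. mon A) A"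
    by (cases "A \<in> Poly_Mapping.keys w")
      (auto simp: lookup_sum lookup_single when_def sum.delta lookup_key in_keys_iff)
qed

lemma sum_keys_add:
  fixes f :: "nat set \<Rightarrow> form"
  shows "(\<Sum>A\<in>Poly_Mapping.keys (v + w). f A)
       = (\<Sum>A\<in>Poly_Mapping.keys v. f A) + (\<Sum>A\<in>Poly_Mapping.keys (w::form). f A)"
proof -
  let ?U = "Poly_Mapping.keys v \<union> Poly_Mapping.keys w"
  have *: "(\<Sum>A\<in>Poly_Mapping.keys u. f A) = (\<Sum>A\<in>?U. scale (Poly_Mapping.lookup u A) (f A))"
    if "Poly_Mapping.keys u \<subseteq> ?U" for u :: form
  proof -
    have "(\<Sum>A\<in>Poly_Mapping.keys u. f A) = (\<Sum>A\<in>Poly_Mapping.keys u. scale (Poly_Mapping.lookup u A) (f A))"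
      by (intro sum.cong refl) (simp add: lookup_key)
    also have "\<dots> = (\<Sum>A\<in>?U. scale (Poly_Mapping.lookup u A) (f A))"
      using that by (intro sum.mono_neutral_left) (auto simp: in_keys_iff)
    finally show ?thesis .
  qed
  have "Poly_Mapping.keys (v + w) \<subseteq> ?U" by (rule Poly_Mapping.keys_add)
  then show ?thesis
    by (simp only: * Un_upper1 Un_upper2 lookup_add scale_add_left sum.distrib)
qed

lemma derivation_zero [simp]: "derivation g 0 = 0"
  by (simp add: derivation_def)

lemma derivation_add: "derivation g (v + w) = derivation g v + derivation g w"
  unfolding derivation_eq by (rule sum_keys_add)

lemma derivation_sum: "derivation g (\<Sum>x\<in>X. f x) = (\<Sum>x\<in>X. derivation g (f x))"
  by (induction X rule: infinite_finite_induct) (auto simp: derivation_add)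

lemma derivation_scale: "derivation g (scale c w) = scale c (derivation g w)"
  by (cases c) auto

lemma derivation_mon: "derivation g (mon A) = (\<Sum>i\<in>A. g i \<and>\<^sub>f mon (A - {i}))"
  by (simp add: derivation_eq)

lemma wedge_zero [simp]: "0 \<and>\<^sub>f w = 0" "w \<and>\<^sub>f 0 = 0"
  by (simp_all add: wedge_def)

lemma wedge_add_left: "(u + v) \<and>\<^sub>f w = u \<and>\<^sub>f w + v \<and>\<^sub>f w"
  unfolding wedge_eq by (rule sum_keys_add)

lemma wedge_add_right: "u \<and>\<^sub>f (v + w) = u \<and>\<^sub>f v + u \<and>\<^sub>f w"
  unfolding wedge_eq by (simp add: sum_keys_add sum.distrib)

lemma wedge_sum_left: "(\<Sum>x\<in>X. f x) \<and>\<^sub>f w = (\<Sum>x\<in>X. f x \<and>\<^sub>f w)"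
  by (induction X rule: infinite_finite_induct) (auto simp: wedge_add_left)

lemma wedge_sum_right: "w \<and>\<^sub>f (\<Sum>x\<in>X. f x) = (\<Sum>x\<in>X. w \<and>\<^sub>f f x)"
  by (induction X rule: infinite_finite_induct) (auto simp: wedge_add_right)

lemma wedge_mon: "mon A \<and>\<^sub>f mon B = (if A \<inter> B = {} then mon (A \<union> B) else 0)"
  by (simp add: wedge_eq)

lemma form_cases_sum:
  assumes "\<And>A. A \<in> Poly_Mapping.keys w \<Longrightarrow> P (mon A)" "P 0" "\<And>u v. P u \<Longrightarrow> P v \<Longrightarrow> P (u + v)"
  shows "P (w::form)"
proof -
  have "P (\<Sum>A\<in>X. mon A)" if "finite X" "X \<subseteq> Poly_Mapping.keys w" for X
    using that by (induction X rule: finite_induct) (auto intro: assms)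
  then show ?thesis by (subst form_sum_mon[of w]) simp
qed

lemma wedge_commute: "v \<and>\<^sub>f w = w \<and>\<^sub>f v"
proof -
  have 1: "mon A \<and>\<^sub>f mon B = mon B \<and>\<^sub>f mon A" for A B
    by (simp add: wedge_mon Int_commute Un_commute)
  have 2: "mon A \<and>\<^sub>f w = w \<and>\<^sub>f mon A" for A
    by (rule form_cases_sum[of w]) (simp_all add: 1 wedge_add_left wedge_add_right)
  show ?thesis
    by (rule form_cases_sum[of v]) (simp_all add: 2 wedge_add_left wedge_add_right)
qed

lemma wedge_assoc: "(u \<and>\<^sub>f v) \<and>\<^sub>f w = u \<and>\<^sub>f (v \<and>\<^sub>f w)"
proof -
  have 1: "(mon A \<and>\<^sub>f mon B) \<and>\<^sub>f mon C = mon A \<and>\<^sub>f (mon B \<and>\<^sub>f mon C)" for A B C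
    by (auto simp: wedge_mon Un_assoc)
  have 2: "(mon A \<and>\<^sub>f mon B) \<and>\<^sub>f w = mon A \<and>\<^sub>f (mon B \<and>\<^sub>f w)" for A B
    by (rule form_cases_sum[of w]) (simp_all add: 1 wedge_add_left wedge_add_right)
  have 3: "(mon A \<and>\<^sub>f v) \<and>\<^sub>f w = mon A \<and>\<^sub>f (v \<and>\<^sub>f w)" for A
    by (rule form_cases_sum[of v]) (simp_all add: 2 wedge_add_left wedge_add_right)
  show ?thesis
    by (rule form_cases_sum[of u]) (simp_all add: 3 wedge_add_left wedge_add_right)
qed

lemma wedge_left_commute: "u \<and>\<^sub>f (v \<and>\<^sub>f w) = v \<and>\<^sub>f (u \<and>\<^sub>f w)"
  by (metis wedge_assoc wedge_commute)

lemma wedge_one [simp]: "mon {} \<and>\<^sub>f w = w" "w \<and>\<^sub>f mon {} = w"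
proof -
  show "mon {} \<and>\<^sub>f w = w"
    by (rule form_cases_sum[of w]) (auto simp: wedge_mon wedge_add_right)
  then show "w \<and>\<^sub>f mon {} = w" by (simp add: wedge_commute)
qed

lemma e_distinct: "distinct is \<Longrightarrow> e_mon is = mon (set is)"
  by (induction "is") (auto simp: e_mon_def wedge_mon)

lemma e_not_distinct: "\<not> distinct is \<Longrightarrow> e_mon is = 0"
proof (induction "is")
  case (Cons i "is")
  have "e_mon (i # is) = mon {i} \<and>\<^sub>f e_mon is" by (simp add: e_mon_def)
  then show ?case using Cons by (cases "distinct is") (auto simp: e_distinct wedge_mon)
qed simp

lemma derivation_generator: "derivation g (e_mon [i]) = g i"
  by (simp add: e_mon_def derivation_mon)

lemma derivation_wedge:
  assumes "\<And>A. A \<in> Poly_Mapping.keys v \<union> Poly_Mapping.keys w \<Longrightarrow> finite A"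
  shows "derivation g (v \<and>\<^sub>f w) = derivation g v \<and>\<^sub>f w + v \<and>\<^sub>f derivation g w"
proof -
  have mm: "derivation g (mon A \<and>\<^sub>f mon B) = derivation g (mon A) \<and>\<^sub>f mon B + mon A \<and>\<^sub>f derivation g (mon B)"
    if fin: "finite A" "finite B" for A B
  proof -
    have R: "derivation g (mon A) \<and>\<^sub>f mon B + mon A \<and>\<^sub>f derivation g (mon B)
      = (\<Sum>i\<in>A. g i \<and>\<^sub>f (mon (A - {i}) \<and>\<^sub>f mon B)) + (\<Sum>i\<in>B. g i \<and>\<^sub>f (mon A \<and>\<^sub>f mon (B - {i})))"
      by (simp add: derivation_mon wedge_sum_left wedge_sum_right wedge_assoc wedge_left_commute)
    show ?thesis
    proof (cases "A \<inter> B = {}")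
      case True
      have "(\<Sum>i\<in>A. g i \<and>\<^sub>f (mon (A - {i}) \<and>\<^sub>f mon B)) = (\<Sum>i\<in>A. g i \<and>\<^sub>f mon (A \<union> B - {i}))"
      proof (intro sum.cong refl)
        fix i assume "i \<in> A"
        then have "(A - {i}) \<inter> B = {}" "(A - {i}) \<union> B = A \<union> B - {i}" using True by auto
        then show "g i \<and>\<^sub>f (mon (A - {i}) \<and>\<^sub>f mon B) = g i \<and>\<^sub>f mon (A \<union> B - {i})"
          by (simp add: wedge_mon)
      qed
      moreover have "(\<Sum>i\<in>B. g i \<and>\<^sub>f (mon A \<and>\<^sub>f mon (B - {i}))) = (\<Sum>i\<in>B. g i \<and>\<^sub>f mon (A \<union> B - {i}))"
      proof (intro sum.cong refl)
        fix i assume "i \<in> B"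
        then have "A \<inter> (B - {i}) = {}" "A \<union> (B - {i}) = A \<union> B - {i}" using True by auto
        then show "g i \<and>\<^sub>f (mon A \<and>\<^sub>f mon (B - {i})) = g i \<and>\<^sub>f mon (A \<union> B - {i})"
          by (simp add: wedge_mon)
      qed
      ultimately show ?thesis
        unfolding R using True fin by (simp add: wedge_mon derivation_mon sum.union_disjoint)
    next
      case False
      have "(\<Sum>i\<in>A. g i \<and>\<^sub>f (mon (A - {i}) \<and>\<^sub>f mon B)) = (\<Sum>i\<in>A \<inter> B. g i \<and>\<^sub>f (mon (A - {i}) \<and>\<^sub>f mon B))"
        using fin False by (intro sum.mono_neutral_right) (auto simp: wedge_mon Diff_Int_distrib2)
      also have "\<dots> = (\<Sum>i\<in>A \<inter> B. g i \<and>\<^sub>f (mon A \<and>\<^sub>f mon (B - {i})))"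
      proof (intro sum.cong refl)
        fix i assume "i \<in> A \<inter> B"
        then have "(A - {i}) \<inter> B = A \<inter> (B - {i})" "(A - {i}) \<union> B = A \<union> (B - {i})" by auto
        then show "g i \<and>\<^sub>f (mon (A - {i}) \<and>\<^sub>f mon B) = g i \<and>\<^sub>f (mon A \<and>\<^sub>f mon (B - {i}))"
          by (simp add: wedge_mon)
      qed
      also have "\<dots> = (\<Sum>i\<in>B. g i \<and>\<^sub>f (mon A \<and>\<^sub>f mon (B - {i})))"
        using fin False by (intro sum.mono_neutral_left) (auto simp: wedge_mon Diff_Int_distrib)
      finally show ?thesis
        unfolding R using False by (simp add: wedge_mon form_double)
    qed
  qed
  have mw: "derivation g (mon A \<and>\<^sub>f w) = derivation g (mon A) \<and>\<^sub>f w + mon A \<and>\<^sub>f derivation g w"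
    if "finite A" for A
    by (rule form_cases_sum[of w])
      (use assms that in \<open>auto simp: mm derivation_add wedge_add_left wedge_add_right add_ac\<close>)
  show ?thesis
    by (rule form_cases_sum[of v])
      (use assms in \<open>auto simp: mw derivation_add wedge_add_left wedge_add_right add_ac\<close>)
qed

lemma keys_sum_subset:
  "A \<in> Poly_Mapping.keys (\<Sum>x\<in>X. f x) \<Longrightarrow> \<exists>x\<in>X. A \<in> Poly_Mapping.keys (f x :: form)"
  using Poly_Mapping.keys_sum[of f X] by blast

lemma D_mon: "D_op (mon A) = (\<Sum>i\<in>A. if 2 < i \<and> i - 1 \<notin> A then mon (insert (i - 1) (A - {i})) else 0)"
  unfolding D_op_def derivation_mon
  by (intro sum.cong refl) (auto simp: e_distinct wedge_mon)

lemma d_mon: "d_op (mon A) = (\<Sum>i\<in>A. if 2 < i \<and> 1 \<notin> A \<and> i - 1 \<notin> A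
    then mon (insert 1 (insert (i - 1) (A - {i}))) else 0)"
  unfolding d_op_def derivation_mon
  by (intro sum.cong refl) (auto simp: e_distinct wedge_mon)

lemma keys_D:
  assumes "A \<in> Poly_Mapping.keys (D_op w)"
  obtains A' i where "A' \<in> Poly_Mapping.keys w" "i \<in> A'" "2 < i" "i - 1 \<notin> A'" "A = insert (i - 1) (A' - {i})"
proof -
  have "D_op w = (\<Sum>A\<in>Poly_Mapping.keys w. D_op (mon A))"
    by (simp only: D_op_def derivation_eq[of _ w] derivation_mon)
  with assms have "A \<in> Poly_Mapping.keys (\<Sum>A\<in>Poly_Mapping.keys w. D_op (mon A))" by simp
  from keys_sum_subset[OF this] obtain A' where A': "A' \<in> Poly_Mapping.keys w"
    "A \<in> Poly_Mapping.keys (D_op (mon A'))" by blast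
  from keys_sum_subset[OF A'(2)[unfolded D_mon]]
  obtain i where "i \<in> A'" "2 < i" "i - 1 \<notin> A'" "A = insert (i - 1) (A' - {i})"
    by (auto split: if_splits)
  with A'(1) show thesis by (rule that)
qed

lemma D_funpow_eq_0:
  assumes "\<And>A. A \<in> Poly_Mapping.keys w \<Longrightarrow> finite A \<and> \<Sum>A < N"
  shows "(D_op ^^ N) w = 0"
  using assms
proof (induction N arbitrary: w)
  case 0
  have "A \<notin> Poly_Mapping.keys w" for A
    using "0.prems"[of A] by auto
  then have "Poly_Mapping.keys w = {}" by (intro equals0I) auto
  then show ?case by simp
next
  case (Suc N)
  have "finite A \<and> \<Sum>A < N" if A: "A \<in> Poly_Mapping.keys (D_op w)" for A
  proof -
    from A obtain A' i where *: "A' \<in> Poly_Mapping.keys w" "i \<in> A'" "2 < i" "i - 1 \<notin> A'"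
      "A = insert (i - 1) (A' - {i})" by (rule keys_D)
    have fin: "finite A'" "\<Sum>A' < Suc N" using Suc.prems[OF *(1)] by auto
    have "\<Sum>A' = i + \<Sum>(A' - {i})" using fin(1) *(2) by (rule sum.remove)
    moreover have "\<Sum>(insert (i - 1) (A' - {i})) = (i - 1) + \<Sum>(A' - {i})"
      using fin(1) *(4) by (intro sum.insert) auto
    ultimately have "\<Sum>(insert (i - 1) (A' - {i})) < N" using fin(2) *(3) by linarith
    then show ?thesis unfolding *(5) using fin(1) by blast
  qed
  then have "(D_op ^^ N) (D_op w) = 0" by (rule Suc.IH)
  then show ?case by (simp only: funpow_Suc_right o_apply)
qed

lemma finite_support_F:
  assumes "\<And>A. A \<in> Poly_Mapping.keys w \<Longrightarrow> finite A"
  shows "finite {l. (D_op ^^ l) w \<and>\<^sub>f e_mon [i + 1 + l] \<noteq> 0}"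
proof -
  let ?N = "Suc (Max (insert 0 (Sum ` Poly_Mapping.keys w)))"
  have "(D_op ^^ l) w = 0" if "?N \<le> l" for l
  proof (rule D_funpow_eq_0)
    fix A assume A: "A \<in> Poly_Mapping.keys w"
    then have le: "\<Sum>A \<le> Max (insert 0 (Sum ` Poly_Mapping.keys w))" by (intro Max_ge) auto
    then show "finite A \<and> \<Sum>A < l" using assms[OF A] that by linarith
  qed
  then have "{l. (D_op ^^ l) w \<and>\<^sub>f e_mon [i + 1 + l] \<noteq> 0} \<subseteq> {..<?N}"
    by (auto simp: not_le[symmetric] simp del: not_le)
  then show ?thesis by (rule finite_subset) simp
qed

lemma d_eq_wedge_D:
  assumes "\<And>A. A \<in> Poly_Mapping.keys w \<Longrightarrow> 1 \<notin> A"
  shows "d_op w = e_mon [1] \<and>\<^sub>f D_op w"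
proof (rule form_cases_sum[of w])
  fix A assume "A \<in> Poly_Mapping.keys w"
  then have "1 \<notin> A" by (rule assms)
  then show "d_op (mon A) = e_mon [1] \<and>\<^sub>f D_op (mon A)"
    by (auto simp: d_mon D_mon e_distinct wedge_sum_right wedge_mon insert_commute
        simp del: One_nat_def intro!: sum.cong)
qed (auto simp: d_op_def D_op_def derivation_add wedge_add_right)

lemma d_op_add: "d_op (v + w) = d_op v + d_op w"
  by (simp add: d_op_def derivation_add)

lemma d_op_zero [simp]: "d_op 0 = 0"
  by (simp add: d_op_def)

lemma d_op_sum: "d_op (\<Sum>x\<in>X. f x) = (\<Sum>x\<in>X. d_op (f x))"
  by (simp add: d_op_def derivation_sum)

lemma d_d_eq_0: "d_op (d_op w) = 0"
proof (rule form_cases_sum[of w])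
  fix A
  have z: "d_op (mon X) = 0" if "1 \<in> X" for X
    using that by (simp add: d_mon)
  show "d_op (d_op (mon A)) = 0"
    unfolding d_mon[of A] d_op_sum by (intro sum.neutral) (auto simp: z)
qed (auto simp: d_op_add)

lemma Lam_zero: "0 \<in> Lam n q"
  by (simp add: Lam_def)

lemma Lam_add: "v \<in> Lam n q \<Longrightarrow> w \<in> Lam n q \<Longrightarrow> v + w \<in> Lam n q"
  using Poly_Mapping.keys_add[of v w] unfolding Lam_def by blast

lemma d_Lam:
  assumes "w \<in> Lam n q"
  shows "d_op w \<in> Lam n (Suc q)"
proof (rule form_cases_sum[of w])
  fix A assume "A \<in> Poly_Mapping.keys w"
  then have A: "A \<subseteq> {1..n}" "card A = q" using assms by (auto simp: Lam_def)
  then have fin: "finite A" using finite_subset by blast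
  show "d_op (mon A) \<in> Lam n (Suc q)"
    unfolding Lam_def mem_Collect_eq
  proof
    fix X assume "X \<in> Poly_Mapping.keys (d_op (mon A))"
    from keys_sum_subset[OF this[unfolded d_mon]]
    obtain i where i: "i \<in> A" "2 < i" "1 \<notin> A" "i - 1 \<notin> A"
      and X: "X = insert 1 (insert (i - 1) (A - {i}))"
      by (auto split: if_splits)
    have "card X = Suc (Suc (card (A - {i})))"
      unfolding X using i fin by (simp add: card_insert_if)
    also have "Suc (card (A - {i})) = q"
      using A(2) i(1) fin by (metis card.remove)
    finally have "card X = Suc q" .
    moreover have "i \<le> n" using i(1) A(1) by auto
    then have "X \<subseteq> {1..n}" using i(2) A(1) unfolding X by auto
    ultimately show "X \<subseteq> {1..n} \<and> card X = Suc q" by blast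
  qed
qed (auto simp: d_op_def derivation_add Lam_zero Lam_add)

lemma coboundaries_subset: "coboundaries n q \<subseteq> cocycles n q"
proof (cases q)
  case 0
  then show ?thesis by (simp add: coboundaries_def cocycles_def Lam_zero d_op_def)
next
  case (Suc q')
  then show ?thesis
    by (auto simp: coboundaries_def cocycles_def d_Lam d_d_eq_0)
qed

lemma coboundaries_zero: "0 \<in> coboundaries n q"
  by (auto simp: coboundaries_def Lam_zero intro!: image_eqI[of _ _ 0])

lemma coboundaries_add:
  "v \<in> coboundaries n q \<Longrightarrow> w \<in> coboundaries n q \<Longrightarrow> v + w \<in> coboundaries n q"
  by (auto simp: coboundaries_def d_op_add[symmetric] Lam_add split: if_splits)

lemma coboundaries_scale: "v \<in> coboundaries n q \<Longrightarrow> scale c v \<in> coboundaries n q"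
  by (cases c) (auto simp: coboundaries_zero)

lemma cocycles_zero: "0 \<in> cocycles n q"
  by (simp add: cocycles_def Lam_zero d_op_def)

lemma cocycles_add: "v \<in> cocycles n q \<Longrightarrow> w \<in> cocycles n q \<Longrightarrow> v + w \<in> cocycles n q"
  by (auto simp: cocycles_def Lam_add d_op_def derivation_add)

lemma cocycles_scale: "v \<in> cocycles n q \<Longrightarrow> scale c v \<in> cocycles n q"
  by (cases c) (auto simp: cocycles_zero)

lemma coh_class_eq_iff: "coh_class n q v = coh_class n q w \<longleftrightarrow> v + w \<in> coboundaries n q"
proof
  assume "coh_class n q v = coh_class n q w"
  then have "v + 0 \<in> coh_class n q w"
    using coboundaries_zero unfolding coh_class_def by blast
  then obtain b where b: "b \<in> coboundaries n q" "v = w + b" by (auto simp: coh_class_def)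
  have "v + w = w + (w + b)" unfolding b(2) by (simp only: add_ac)
  then show "v + w \<in> coboundaries n q" using b(1) by simp
next
  assume vw: "v + w \<in> coboundaries n q"
  have "coh_class n q x \<subseteq> coh_class n q y" if xy: "x + y \<in> coboundaries n q" for x y
  proof
    fix z assume "z \<in> coh_class n q x"
    then obtain b where b: "b \<in> coboundaries n q" "z = x + b" by (auto simp: coh_class_def)
    have "z = y + ((x + y) + b)"
      using b(2) form_cancel[of y "x + b"] by (simp only: add_ac)
    then show "z \<in> coh_class n q y" using coboundaries_add[OF xy b(1)] by (auto simp: coh_class_def)
  qed
  from this[OF vw] this[of w v] vw show "coh_class n q v = coh_class n q w"
    by (simp add: add.commute)
qed

lemma cohomology_add:
  "add (cohomology n q) (coh_class n q v) (coh_class n q w) = coh_class n q (v + w)"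
proof -
  have "{x + y | x y. x \<in> coh_class n q v \<and> y \<in> coh_class n q w} = coh_class n q (v + w)" (is "?L = ?R")
  proof (rule Set.set_eqI, rule iffI)
    fix z assume "z \<in> ?L"
    then obtain x y where xy: "x \<in> coboundaries n q" "y \<in> coboundaries n q" "z = (v + x) + (w + y)"
      unfolding coh_class_def by blast
    have "z = (v + w) + (x + y)" using xy(3) by (simp add: add_ac)
    then show "z \<in> ?R" using coboundaries_add[OF xy(1,2)] unfolding coh_class_def by blast
  next
    fix z assume "z \<in> ?R"
    then obtain b where b: "b \<in> coboundaries n q" "z = (v + w) + b" unfolding coh_class_def by blast
    have "z = (v + b) + (w + 0)" using b(2) by (simp add: add_ac)
    then show "z \<in> ?L" using b(1) coboundaries_zero unfolding coh_class_def by blast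
  qed
  then show ?thesis by (simp add: cohomology_def)
qed

lemma cohomology_smult:
  "smult (cohomology n q) c (coh_class n q v) = coh_class n q (scale c v)"
proof -
  have "{scale c x + b | x b. x \<in> coh_class n q v \<and> b \<in> coboundaries n q} = coh_class n q (scale c v)"
    (is "?L = ?R")
  proof (rule Set.set_eqI, rule iffI)
    fix z assume "z \<in> ?L"
    then obtain x b where xb: "x \<in> coboundaries n q" "b \<in> coboundaries n q" "z = scale c (v + x) + b"
      unfolding coh_class_def by blast
    have "z = scale c v + (scale c x + b)" using xb(3) by (simp add: scale_add add_ac)
    then show "z \<in> ?R"
      using coboundaries_add[OF coboundaries_scale[OF xb(1)] xb(2)] unfolding coh_class_def by blast
  next
    fix z assume "z \<in> ?R"
    then obtain b where b: "b \<in> coboundaries n q" "z = scale c v + b" unfolding coh_class_def by blast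
    have "z = scale c (v + 0) + b" using b(2) by simp
    then show "z \<in> ?L" using b(1) coboundaries_zero unfolding coh_class_def by blast
  qed
  then show ?thesis by (simp add: cohomology_def)
qed

lemma cohomology_carrier: "carrier (cohomology n q) = coh_class n q ` cocycles n q"
  by (simp add: cohomology_def)

lemma cohomology_zero: "zero (cohomology n q) = coh_class n q 0"
  by (simp add: cohomology_def coh_class_def)

lemma cohomology_vectorspace: "vectorspace class_ring (cohomology n q)"
proof -
  note simps = cohomology_carrier cohomology_zero cohomology_add cohomology_smult
  have "abelian_group (cohomology n q)"
  proof (rule abelian_groupI)
    fix x assume "x \<in> carrier (cohomology n q)"
    then obtain v where "v \<in> cocycles n q" "x = coh_class n q v" by (auto simp: simps)
    then show "\<exists>y\<in>carrier (cohomology n q). y \<oplus>\<^bsub>cohomology n q\<^esub> x = \<zero>\<^bsub>cohomology n q\<^esub>"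
      by (intro bexI[of _ x]) (auto simp: simps form_double)
  qed (auto simp: simps cocycles_zero cocycles_add add_ac)
  then have "Module.module class_ring (cohomology n q)"
    by (intro moduleI class_cring.cring_axioms)
      (auto simp add: simps cocycles_scale scale_add scale_add_left scale_scale simp del: add_bit_eq_xor mult_bit_eq_and)
  then show ?thesis
    by (intro vectorspace.intro class_field)
qed

lemma ex1_pm:
  assumes "2 \<le> t"
  shows "\<exists>!(p, m). t = 2 ^ p + m \<and> 0 < m \<and> m \<le> (2::nat) ^ p"
proof -
  obtain p where p: "2 ^ p \<le> t - 1" "t - 1 < 2 ^ (p + 1)"
    using ex_power_ivl1[of 2 "t - 1"] assms by fastforce
  show ?thesis
  proof (rule ex1I[of _ "(p, t - 2 ^ p)"])
    fix x :: "nat \<times> nat"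
    assume "case x of (p, m) \<Rightarrow> t = 2 ^ p + m \<and> 0 < m \<and> m \<le> 2 ^ p"
    then obtain p' m' where x: "x = (p', m')" and *: "t = 2 ^ p' + m'" "0 < m'" "m' \<le> 2 ^ p'"
      by (cases x) auto
    have "(2::nat) ^ p < 2 ^ (p' + 1)" "(2::nat) ^ p' < 2 ^ (p + 1)" using p * by simp_all
    then have "p < p' + 1" "p' < p + 1" by (simp_all only: power_strict_increasing_iff)
    then have "p = p'" by simp
    then show "x = (p, t - 2 ^ p)" using x * by simp
  qed (use p assms in auto)
qed

end

theory Submission
  imports Defs "HOL-Computational_Algebra.Polynomial"
begin

text \<open>
  Splitting off the generator with index 1 gives
  \<open>H\<^sup>3 = ker (D on 3-forms) \<oplus> e\<^sup>1 \<and> coker (D on 2-forms)\<close>, all forms being in the indices \<open>2, \<dots>, n\<close>.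
  On 2-forms \<open>e\<^sup>a \<and> e\<^sup>b\<close> and \<open>e\<^sup>a\<^sup>-\<^sup>1 \<and> e\<^sup>b\<^sup>+\<^sup>1\<close> agree modulo the image of \<open>D\<close>, which leaves one class in
  each odd weight \<open>2k + 1\<close> with \<open>2k > n\<close>.

  The kernel on 3-forms is filtered by the largest index \<open>t\<close>.  The coefficient of \<open>e\<^sup>t\<close> lies in the kernel
  of \<open>D\<close> on 2-forms, so it is a combination of the forms \<open>z\<^sub>k\<close>, the sum of all \<open>e\<^sup>v \<and> e\<^sup>w\<close> with
  \<open>2 \<le> v < w\<close> and \<open>v + w = 2k + 1\<close>; it also equals a sum of terms \<open>D\<^sup>t\<^sup>-\<^sup>1\<^sup>-\<^sup>r (e\<^sup>i \<and> e\<^sup>r)\<close> whose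
  coefficients are those of the form at \<open>{i, r, r + 1}\<close>.  Hence the claim is that \<open>z\<^sub>k\<close> occurs exactly
  for \<open>2 \<le> k \<le> m\<close>.  The coefficients of \<open>D\<^sup>l (e\<^sup>x \<and> e\<^sup>y)\<close> are those of \<open>(X\<^sup>v + X\<^sup>w)(1 + X)\<^sup>l\<close>.
  For \<open>k \<le> m\<close> the binomial coefficients in \<open>B_form\<close> turn the sum into a coefficient of
  \<open>(X\<^sup>v + X\<^sup>w)(1 + X + X\<^sup>2)\<^sup>m\<^sup>-\<^sup>k\<close> times the sum of \<open>(X + X\<^sup>2)\<close> to the powers \<open>2\<^sup>s - 1\<close>, \<open>s < p\<close>, and the latter
  telescopes by Frobenius.  For \<open>k > m\<close> pairing with the palindrome
  \<open>X\<^sup>m\<^sup>+\<^sup>1(1 + X)(1 + X + X\<^sup>2)\<^sup>k\<^sup>-\<^sup>m\<^sup>-\<^sup>1\<close> kills all the terms but not \<open>z\<^sub>k\<close>, because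
  the binomial coefficient of \<open>2\<^sup>p - 1 - q\<close> over \<open>q\<close> is even for \<open>q > 0\<close>.
\<close>

section \<open>Coefficients of forms under \<open>D\<close>\<close>

declare add_bit_eq_xor [simp del] mult_bit_eq_and [simp del]

abbreviation coef :: "form \<Rightarrow> nat set \<Rightarrow> bit" where
  "coef \<equiv> Poly_Mapping.lookup"

definition homog :: "nat \<Rightarrow> form \<Rightarrow> bool" where
  "homog q w \<longleftrightarrow> (\<forall>A\<in>Poly_Mapping.keys w. finite A \<and> card A = q)"

lemma bit_double [simp]: "(b::bit) + b = 0"
  by (cases b) simp_all

lemma bit_add_eq_0_iff: "(a::bit) + b = 0 \<longleftrightarrow> a = b"
  by (cases a; cases b) simp_all

lemma coef_mon: "coef (mon A) B = of_bool (A = B)"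
  by (simp add: lookup_single when_def)

lemma coef_sum: "coef (\<Sum>x\<in>X. f x) A = (\<Sum>x\<in>X. coef (f x) A)"
  by (rule lookup_sum)

lemma coef_homog_eq_0: "homog q w \<Longrightarrow> card A \<noteq> q \<Longrightarrow> coef w A = 0"
  by (metis homog_def in_keys_iff)

lemma homog_zero [simp]: "homog q 0"
  by (simp add: homog_def)

lemma homog_mon: "finite A \<Longrightarrow> card A = q \<Longrightarrow> homog q (mon A)"
  by (simp add: homog_def)

lemma homog_add: "homog q v \<Longrightarrow> homog q w \<Longrightarrow> homog q (v + w)"
  using Poly_Mapping.keys_add[of v w] unfolding homog_def by blast

lemma homog_scale: "homog q v \<Longrightarrow> homog q (scale c v)"
  by (cases c) auto

lemma homog_sum: "(\<And>x. x \<in> X \<Longrightarrow> homog q (f x)) \<Longrightarrow> homog q (\<Sum>x\<in>X. f x)"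
  by (induction X rule: infinite_finite_induct) (auto simp: homog_add)

lemma homog_D:
  assumes "homog q w"
  shows "homog q (D_op w)"
  unfolding homog_def
proof
  fix A assume "A \<in> Poly_Mapping.keys (D_op w)"
  then obtain B i where B: "B \<in> Poly_Mapping.keys w" "i \<in> B" "2 < i" "i - 1 \<notin> B" "A = insert (i - 1) (B - {i})"
    by (rule keys_D)
  with assms have "finite B" "card B = q" by (auto simp: homog_def)
  moreover have "card B = Suc (card (B - {i}))"
    using \<open>finite B\<close> B(2) by (rule card.remove)
  ultimately show "finite A \<and> card A = q"
    using B(4) unfolding B(5) by (metis Diff_iff card_insert_disjoint finite_Diff finite_insert)
qed

lemma homog_D_pow: "homog q w \<Longrightarrow> homog q ((D_op ^^ l) w)"
  by (induction l) (auto intro: homog_D)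

lemma D_zero [simp]: "D_op 0 = 0"
  by (simp add: D_op_def)

lemma D_add: "D_op (v + w) = D_op v + D_op w"
  by (simp add: D_op_def derivation_add)

lemma D_sum: "D_op (\<Sum>x\<in>X. f x) = (\<Sum>x\<in>X. D_op (f x))"
  by (simp add: D_op_def derivation_sum)

lemma D_scale: "D_op (scale c w) = scale c (D_op w)"
  by (simp add: D_op_def derivation_scale)

lemma D_pow_zero [simp]: "(D_op ^^ l) 0 = 0"
  by (induction l) auto

text \<open>The monomials of \<open>w\<close> that contribute at \<open>A\<close> arise by raising
  one index of \<open>A\<close>. If \<open>Suc a\<close> already lies in \<open>A\<close>, the
  raised set has fewer than \<open>card A\<close> elements and homogeneity makes its coefficient
  zero.\<close>

lemma coef_D:
  assumes w: "homog (card A) w" and A: "finite A" "A \<subseteq> {2..}"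
  shows "coef (D_op w) A = (\<Sum>a\<in>A. coef w (insert (Suc a) (A - {a})))"
proof (rule form_cases_sum[of w])
  fix B assume "B \<in> Poly_Mapping.keys w"
  then have B: "finite B" "card B = card A" using w by (auto simp: homog_def)
  let ?P = "\<lambda>i. 2 < i \<and> i - 1 \<notin> B \<and> insert (i - 1) (B - {i}) = A"
  let ?Q = "\<lambda>a. B = insert (Suc a) (A - {a})"
  have bij: "bij_betw Suc {a\<in>A. ?Q a} {i\<in>B. ?P i}"
  proof (rule bij_betwI[where g = "\<lambda>i. i - 1"])
    show "Suc \<in> {a\<in>A. ?Q a} \<rightarrow> {i\<in>B. ?P i}"
    proof
      fix a assume "a \<in> {a\<in>A. ?Q a}"
      then have a: "a \<in> A" "B = insert (Suc a) (A - {a})" by auto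
      have "Suc a \<notin> A"
      proof
        assume "Suc a \<in> A"
        then have "B = A - {a}" using a by auto
        then have "card A = Suc (card B)" using card.remove[OF A(1) a(1)] by (simp only:)
        then show False using B(2) by simp
      qed
      then show "Suc a \<in> {i\<in>B. ?P i}" using a A by auto
    qed
  next
    show "(\<lambda>i. i - 1) \<in> {i\<in>B. ?P i} \<rightarrow> {a\<in>A. ?Q a}"
      by auto
  qed auto
  have "coef (D_op (mon B)) A = (\<Sum>i\<in>B. of_bool (?P i))"
    unfolding D_mon coef_sum by (intro sum.cong refl) (auto simp: coef_mon)
  also have "\<dots> = (\<Sum>i\<in>{i\<in>B. ?P i}. 1)"
    unfolding of_bool_def by (rule sum.inter_filter[OF B(1), symmetric])
  also have "\<dots> = (\<Sum>a\<in>{a\<in>A. ?Q a}. 1)"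
    by (rule sum.reindex_bij_betw[OF bij, symmetric])
  also have "\<dots> = (\<Sum>a\<in>A. coef (mon B) (insert (Suc a) (A - {a})))"
    unfolding of_bool_def coef_mon by (rule sum.inter_filter[OF A(1)])
  finally show "coef (D_op (mon B)) A = (\<Sum>a\<in>A. coef (mon B) (insert (Suc a) (A - {a})))" .
qed (simp_all add: D_add lookup_add sum.distrib)

lemma coef_D2_distinct:
  assumes "homog 2 w" "2 \<le> a" "2 \<le> b" "a \<noteq> b"
  shows "coef (D_op w) {a, b} = coef w {Suc a, b} + coef w {a, Suc b}"
proof -
  have 1: "{a, b} - {a} = {b}" "{a, b} - {b} = {a}" "card {a, b} = 2" "{Suc b, a} = {a, Suc b}"
    using assms by auto
  have "coef (D_op w) {a, b} = (\<Sum>x\<in>{a, b}. coef w (insert (Suc x) ({a, b} - {x})))"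
    by (rule coef_D) (use assms in \<open>simp_all add: 1(3)\<close>)
  also have "\<dots> = coef w {Suc a, b} + coef w {Suc b, a}"
    using assms(4) by (simp add: 1(1,2))
  finally show ?thesis unfolding 1(4) .
qed

lemma coef_D3:
  assumes "homog 3 w" "2 \<le> a" "2 \<le> b" "2 \<le> c" "a \<noteq> b" "a \<noteq> c" "b \<noteq> c"
  shows "coef (D_op w) {a, b, c} = coef w {Suc a, b, c} + coef w {a, Suc b, c} + coef w {a, b, Suc c}"
proof -
  have 1: "{a, b, c} - {a} = {b, c}" "{a, b, c} - {b} = {a, c}" "{a, b, c} - {c} = {a, b}"
     "card {a, b, c} = 3" "{Suc b, a, c} = {a, Suc b, c}" "{Suc c, a, b} = {a, b, Suc c}"
    using assms by auto
  have "coef (D_op w) {a, b, c} = (\<Sum>x\<in>{a, b, c}. coef w (insert (Suc x) ({a, b, c} - {x})))"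
    by (rule coef_D) (use assms in \<open>simp_all add: 1(4)\<close>)
  also have "\<dots> = coef w {Suc a, b, c} + (coef w {Suc b, a, c} + coef w {Suc c, a, b})"
    using assms(5-7) by (simp add: 1(1-3))
  finally show ?thesis unfolding 1(5,6) by (simp only: add.assoc)
qed

text \<open>For \<open>a = b\<close> both sides vanish: the left is a coefficient at a singleton,
  and the two equal terms on the right cancel.\<close>

lemma coef_D2:
  assumes "homog 2 w" "2 \<le> a" "2 \<le> b"
  shows "coef (D_op w) {a, b} = coef w {Suc a, b} + coef w {a, Suc b}"
proof (cases "a = b")
  case True
  have "coef (D_op w) {b} = 0"
    by (rule coef_homog_eq_0[OF homog_D[OF assms(1)]]) simp
  moreover have "{b, Suc b} = {Suc b, b}" by auto
  ultimately show ?thesis using True by simp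
qed (use coef_D2_distinct assms in auto)

text \<open>Zero when an index is below 2, so that truncated subtraction of indices is harmless.\<close>

definition e2 :: "nat \<Rightarrow> nat \<Rightarrow> form" where
  "e2 x y = (if 2 \<le> x \<and> 2 \<le> y \<and> x \<noteq> y then mon {x, y} else 0)"

lemma homog_e2: "homog 2 (e2 x y)"
  by (simp add: e2_def homog_mon)

lemma poly_bit_double [simp]: "(p::bit poly) + p = 0"
  by (rule poly_eqI) (simp only: coeff_add bit_double coeff_0)

lemma monom_Suc_eq: "monom (1::bit) (Suc n) = [:0, 1:] * monom 1 n"
  by (simp add: monom_Suc)

lemma one_plus_X: "[:1, 1:] = 1 + [:0, 1 :: bit:]"
  by (rule poly_eqI) (simp add: coeff_pCons split: nat.split)

text \<open>In the coefficient, each \<open>D_op\<close> raises \<open>v\<close> or \<open>w\<close>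
  by one, and (X^(v+1) + X^w) + (X^v + X^(w+1)) = (1 + X)(X^v + X^w). The weight
  \<open>x + y\<close> determines \<open>x\<close> from \<open>y\<close>, so it suffices that
  exponents record \<open>y\<close>.\<close>

lemma coef_D_pow_e2:
  assumes "2 \<le> v" "2 \<le> w"
  shows "coef ((D_op ^^ l) (e2 x y)) {v, w} =
    (if x + y = l + v + w then coeff ((monom 1 v + monom 1 w) * [:1, 1:] ^ l) y else 0)"
  using assms
proof (induction l arbitrary: v w)
  case 0
  have zero: "coef (e2 x y) {w} = 0" by (rule coef_homog_eq_0[OF homog_e2]) simp
  have "coef (e2 x y) {v, w} = of_bool (x + y = v + w) * (of_bool (v = y) + of_bool (w = y))"
    using 0 zero by (cases "v = w") (auto simp: e2_def coef_mon doubleton_eq_iff)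
  then show ?case
    by (simp add: of_bool_def)
next
  case (Suc l)
  let ?p = "[:1, 1:] :: bit poly"
  have eq: "(monom 1 (Suc v) + monom 1 w) * ?p ^ l + (monom 1 v + monom 1 (Suc w)) * ?p ^ l
    = (monom 1 v + monom 1 w) * ?p ^ Suc l"
    unfolding monom_Suc_eq power_Suc one_plus_X by (simp only: algebra_simps mult_1_left)
  have "coef ((D_op ^^ Suc l) (e2 x y)) {v, w} =
      coef ((D_op ^^ l) (e2 x y)) {Suc v, w} + coef ((D_op ^^ l) (e2 x y)) {v, Suc w}"
    using coef_D2[OF homog_D_pow[OF homog_e2] Suc.prems] by simp
  also have "\<dots> = (if x + y = Suc l + v + w then coeff ((monom 1 (Suc v) + monom 1 w) * ?p ^ l
     + (monom 1 v + monom 1 (Suc w)) * ?p ^ l) y else 0)"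
    using Suc.prems by (simp add: Suc.IH del: power_Suc mult_pCons_left mult_pCons_right)
  finally show ?case unfolding eq .
qed

section \<open>Polynomials over the two-element field\<close>

lemma square_pCons_bit: "(pCons (a::bit) q)\<^sup>2 = pCons a (pCons 0 (q\<^sup>2))"
proof -
  have "pCons a q = [:a:] + [:0, 1:] * q" by simp
  then have "(pCons a q)\<^sup>2 = [:a:]\<^sup>2 + ([:0, 1:] * q * [:a:] + [:0, 1:] * q * [:a:]) + [:0, 1:] * [:0, 1:] * q\<^sup>2"
    by (simp only: power2_eq_square algebra_simps)
  also have "\<dots> = [:a:]\<^sup>2 + [:0, 1:] * [:0, 1:] * q\<^sup>2"
    by (simp only: poly_bit_double add_0_right)
  also have "\<dots> = pCons a (pCons 0 (q\<^sup>2))"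
    by (cases a) (simp_all add: power2_eq_square)
  finally show ?thesis .
qed

text \<open>Squaring is additive and fixes constants, so it sends a_0 + a_1 X + ... to a_0 + a_1 X^2
  + ....\<close>

lemma coeff_square_bit_even: "coeff ((p::bit poly)\<^sup>2) (2 * n) = coeff p n"
proof (induction p arbitrary: n)
  case (pCons a q)
  show ?case
    unfolding square_pCons_bit using pCons.IH[of "n - 1"] by (cases n) simp_all
qed simp

lemma coeff_square_bit_odd: "coeff ((p::bit poly)\<^sup>2) (Suc (2 * n)) = 0"
proof (induction p arbitrary: n)
  case (pCons a q)
  show ?case
    unfolding square_pCons_bit using pCons.IH[of "n - 1"] by (cases n) simp_all
qed simp

lemma add_power_two_power_bit: "((x::bit poly) + y) ^ 2 ^ s = x ^ 2 ^ s + y ^ 2 ^ s"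
proof (induction s)
  case (Suc s)
  have "(u + v)\<^sup>2 = u\<^sup>2 + v\<^sup>2" for u v :: "bit poly"
  proof -
    have "(u + v)\<^sup>2 = u\<^sup>2 + (u * v + u * v) + v\<^sup>2"
      by (simp only: power2_eq_square algebra_simps)
    then show ?thesis by (simp only: poly_bit_double add_0_right)
  qed
  then show ?case using Suc
    by (simp only: power_Suc2 power_mult)
qed simp

text \<open>This is the parity of the binomial coefficient of \<open>2 ^ p - 1 - q\<close> over
  \<open>q\<close>. For odd \<open>q\<close> the exponent is even and the power is a square, without
  odd terms. For even \<open>q\<close> the power is 1 + X times a square, and halving
  \<open>q\<close> lowers \<open>p\<close> by one.\<close>

lemma coeff_one_plus_X_power_diag:
  assumes "0 < q" "q < 2 ^ p"
  shows "coeff ([:1, 1::bit:] ^ (2 ^ p - 1 - q)) q = 0"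
  using assms
proof (induction p arbitrary: q)
  case (Suc p)
  show ?case
  proof (cases "even q")
    case False
    then obtain b where q: "q = Suc (2 * b)" by (auto elim: oddE)
    have "2 ^ Suc p - 1 - q = (2 ^ p - 1 - b) * 2" unfolding q power_Suc by arith
    then show ?thesis unfolding q by (simp only: power_mult coeff_square_bit_odd)
  next
    case True
    then obtain b where q: "q = 2 * Suc b"
      using Suc.prems(1) by (metis evenE gr0_implies_Suc mult_0_right neq0_conv)
    have b: "Suc b < 2 ^ p" using Suc.prems(2) unfolding q by simp
    let ?S = "[:1, 1::bit:] ^ (2 ^ p - 1 - Suc b)"
    have "2 ^ Suc p - 1 - q = Suc ((2 ^ p - 1 - Suc b) * 2)" unfolding q power_Suc using b by arith
    then have "[:1, 1:] ^ (2 ^ Suc p - 1 - q) = [:1, 1:] * ?S\<^sup>2"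
      by (simp only: power_Suc power_mult)
    also have "\<dots> = ?S\<^sup>2 + pCons 0 (?S\<^sup>2)" by simp
    finally have "coeff ([:1, 1:] ^ (2 ^ Suc p - 1 - q)) q
      = coeff (?S\<^sup>2) (2 * Suc b) + coeff (?S\<^sup>2) (Suc (2 * b))"
      unfolding q by (simp only: coeff_add mult_Suc_right add_2_eq_Suc coeff_pCons_Suc)
    also have "\<dots> = 0"
      unfolding coeff_square_bit_even coeff_square_bit_odd using Suc.IH[OF zero_less_Suc b] by simp
    finally show ?thesis .
  qed
qed simp

section \<open>Powers of 1 + X + X^2\<close>

lemma X_power: "[:0, 1::bit:] ^ n = monom 1 n"
  by (simp add: monom_altdef)

lemma trinomial_eq: "[:1, 1, 1::bit:] = [:0, 1:] * [:1, 1:] + 1"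
  by (rule poly_eqI) (simp add: coeff_pCons split: nat.split)

text \<open>In the binomial expansion of (1 + X (1 + X))^n the term with index i asks for the
  coefficient of (1 + X)^(2^p - 1 - (R - i)) at R - i, which is positive.\<close>

lemma coeff_trinomial_power_times:
  assumes "n < R" "R < 2 ^ p"
  shows "coeff ([:1, 1, 1::bit:] ^ n * [:1, 1:] ^ (2 ^ p - 1 - R)) R = 0"
proof -
  have "coeff (([:0, 1:] * [:1, 1::bit:]) ^ i * [:1, 1:] ^ (2 ^ p - 1 - R)) R = 0" if "i \<le> n" for i
  proof -
    have "i + (2 ^ p - 1 - R) = 2 ^ p - 1 - (R - i)" using that assms by linarith
    then have "([:0, 1:] * [:1, 1::bit:]) ^ i * [:1, 1:] ^ (2 ^ p - 1 - R)
      = monom 1 i * [:1, 1:] ^ (2 ^ p - 1 - (R - i))"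
      by (simp only: power_mult_distrib X_power mult.assoc flip: power_add)
    then show ?thesis
      using coeff_one_plus_X_power_diag[of "R - i" p] that assms by (simp add: coeff_monom_mult)
  qed
  then show ?thesis
    unfolding trinomial_eq binomial_ring sum_distrib_right coeff_sum
    by (intro sum.neutral) (simp add: mult.assoc of_nat_poly)
qed

text \<open>Division by 1 + X is multiplication by the power series 1 + X + X^2 + ..., which forms
  partial sums.\<close>

lemma coeff_one_plus_X_mult:
  assumes "[:1, 1::bit:] * U = R"
  shows "coeff U n = (\<Sum>i\<le>n. coeff R i)"
proof (induction n)
  case 0
  then show ?case using assms by auto
next
  case (Suc n)
  have "coeff R (Suc n) = coeff U (Suc n) + coeff U n"
    unfolding assms[symmetric] by simp
  then show ?case using Suc by (cases "coeff U n"; cases "coeff U (Suc n)") simp_all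
qed

lemma sum_coeff_monom_mult:
  "(\<Sum>i\<le>N. coeff (monom (1::bit) v * p) i) = (\<Sum>i<Suc N - v. coeff p i)"
proof -
  have "(\<Sum>i\<le>N. coeff (monom (1::bit) v * p) i) = (\<Sum>i\<in>{v..N}. coeff p (i - v))"
    by (intro sum.mono_neutral_cong_right) (auto simp: coeff_monom_mult)
  also have "\<dots> = (\<Sum>i<Suc N - v. coeff p i)"
    by (rule sum.reindex_bij_witness[of _ "\<lambda>i. i + v" "\<lambda>i. i - v"]) auto
  finally show ?thesis .
qed

abbreviation trin :: "nat \<Rightarrow> bit poly" where
  "trin M \<equiv> [:1, 1, 1:] ^ M"

lemma degree_trin: "degree (trin M) = 2 * M"
  by (simp add: degree_power_eq)

lemma sum_trin_ge:
  assumes "2 * M < N"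
  shows "(\<Sum>i<N. coeff (trin M) i) = 1"
proof -
  have "(\<Sum>i<N. coeff (trin M) i) = (\<Sum>i\<le>2 * M. coeff (trin M) i)"
    using assms by (intro sum.mono_neutral_right) (auto intro!: coeff_eq_0 simp: degree_trin)
  also have "\<dots> = poly (trin M) 1"
    by (simp only: poly_altdef degree_trin power_one mult_1_right)
  also have "\<dots> = 1" by (simp add: poly_power)
  finally show ?thesis .
qed

lemma coeff_trin_reflect: "i \<le> 2 * M \<Longrightarrow> coeff (trin M) (2 * M - i) = coeff (trin M) i"
proof -
  assume i: "i \<le> 2 * M"
  have "reflect_poly (trin M) = trin M"
    unfolding reflect_poly_power by (simp add: reflect_poly_def)
  then have "coeff (trin M) i = coeff (reflect_poly (trin M)) i" by simp
  also have "\<dots> = coeff (trin M) (2 * M - i)"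
    using i unfolding coeff_reflect_poly degree_trin by simp
  finally show ?thesis ..
qed

text \<open>Reversing the palindrome turns the second partial sum into the tail that the first one
  omits, so together they give the value at 1.\<close>

lemma sum_trin_complementary:
  assumes "A + B = 2 * M + 1"
  shows "(\<Sum>i<A. coeff (trin M) i) + (\<Sum>i<B. coeff (trin M) i) = 1"
proof -
  have "(\<Sum>i<B. coeff (trin M) i) = (\<Sum>i\<in>{A..<2*M+1}. coeff (trin M) i)"
    using assms
    by (intro sum.reindex_bij_witness[of _ "\<lambda>i. 2 * M - i" "\<lambda>i. 2 * M - i"]) (auto simp: coeff_trin_reflect)
  moreover have "(\<Sum>i<A. coeff (trin M) i) + (\<Sum>i\<in>{A..<2*M+1}. coeff (trin M) i) = (\<Sum>i<2*M+1. coeff (trin M) i)"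
    using assms by (simp only: lessThan_atLeast0) (rule sum.atLeastLessThan_concat, auto)
  ultimately show ?thesis using sum_trin_ge[of M "2*M+1"] by simp
qed

text \<open>Frobenius gives (X + X^2)^(2^s) = X^(2^s) + X^(2^(s+1)), and neighbouring summands
  cancel.\<close>

lemma sum_frobenius_telescope:
  "(\<Sum>s<p. ([:0, 1:] * [:1, 1::bit:]) ^ 2 ^ s) = [:0, 1:] + monom 1 (2 ^ p)"
proof (induction p)
  case 0
  show ?case using poly_bit_double[of "[:0, 1:]"] by (simp add: monom_altdef)
next
  case (Suc p)
  have "[:0, 1:] * [:1, 1::bit:] = monom 1 1 + monom 1 2"
    by (simp add: monom_altdef power2_eq_square)
  then have "([:0, 1:] * [:1, 1::bit:]) ^ 2 ^ p = monom 1 (2 ^ p) + monom 1 (2 ^ Suc p)"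
    by (simp add: add_power_two_power_bit monom_power del: mult_pCons_left mult_pCons_right)
  then show ?case
    using poly_bit_double[of "monom 1 (2 ^ p)"]
    unfolding sum.lessThan_Suc Suc by (simp only: add.assoc) (simp only: add.assoc[symmetric] add_0_left add_0_right)
qed

text \<open>Used to replace a coefficient index that varies with the exponent by a fixed
  one.\<close>

lemma coeff_X_one_plus_X_power:
  "coeff (q * ([:0, 1:] * [:1, 1::bit:]) ^ l) n = (if n < l then 0 else coeff (q * [:1, 1:] ^ l) (n - l))"
proof -
  have "q * ([:0, 1:] * [:1, 1::bit:]) ^ l = monom 1 l * (q * [:1, 1:] ^ l)"
    by (simp only: power_mult_distrib X_power mult.assoc mult.left_commute)
  then show ?thesis by (simp only: coeff_monom_mult mult_1_left)
qed

lemma coeff_monom_one_plus_X_eq_0: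
  assumes "v + l < r"
  shows "coeff (monom 1 v * [:1, 1::bit:] ^ l) r = 0"
  using assms by (simp add: coeff_monom_mult coeff_eq_0 degree_power_eq)

text \<open>As (1 + X)^(2^p) = 1 + X^(2^p), the product consists of two copies of X^v (1 + X)^l: one
  has degree below \<open>r\<close>, the other starts above \<open>r\<close>.\<close>

lemma coeff_monom_one_plus_X_large_eq_0:
  assumes "v + l < r" "r < 2 ^ p"
  shows "coeff (monom 1 v * [:1, 1::bit:] ^ (2 ^ p + l)) r = 0"
proof -
  have "[:1, 1::bit:] ^ 2 ^ p = 1 + monom 1 (2 ^ p)"
    unfolding one_plus_X add_power_two_power_bit by (simp add: X_power)
  then have "monom 1 v * [:1, 1::bit:] ^ (2 ^ p + l) =
     monom 1 v * [:1, 1:] ^ l + monom 1 (2 ^ p) * (monom 1 v * [:1, 1:] ^ l)"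
    by (simp only: power_add distrib_left distrib_right mult_1_left mult_1_right ac_simps)
  then show ?thesis
    using coeff_monom_one_plus_X_eq_0[OF assms(1)] assms(2)
    by (simp only: coeff_add) (simp add: coeff_monom_mult)
qed

text \<open>With g_v = X^v + X^(2k+1-v), the sum g_(v-1) + g_v + g_(v+1) is g_v times (1 + X + X^2)
  / X. Each step therefore triples the list and keeps its length odd. Lists allow for repeated
  entries.\<close>

lemma odd_palindrome_basis:
  assumes "Suc n < k"
  shows "\<exists>vs. odd (length vs) \<and> set vs \<subseteq> {k - n..k + n + 1} \<and>
    (\<Sum>v\<leftarrow>vs. monom 1 v + monom 1 (2 * k + 1 - v)) = monom 1 (k - n) * [:1, 1:] * trin n"
  using assms
proof (induction n)
  case 0
  have "(monom 1 k + monom 1 (Suc k) :: bit poly) = monom 1 k * [:1, 1:]"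
    unfolding monom_Suc_eq one_plus_X by (simp only: distrib_left mult_1_left mult_1_right ac_simps)
  then show ?case by (intro exI[of _ "[k]"]) auto
next
  case (Suc n)
  then obtain vs where vs: "odd (length vs)" "set vs \<subseteq> {k - n..k + n + 1}"
    "(\<Sum>v\<leftarrow>vs. monom 1 v + monom 1 (2 * k + 1 - v)) = monom 1 (k - n) * [:1, 1:] * trin n"
    by auto
  let ?g = "\<lambda>v. monom 1 v + monom 1 (2 * k + 1 - v) :: bit poly"
  let ?X = "[:0, 1::bit:]"
  let ?vs = "map (\<lambda>v. v - 1) vs @ vs @ map Suc vs"
  \<comment> \<open>The factor X clears the denominator and is cancelled at the end of the induction
    step.\<close>
  have key: "?X * (?g (v - 1) + (?g v + ?g (Suc v))) = (?X * [:1, 1:] + 1) * ?g v" if v: "v \<in> set vs" for v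
  proof -
    have "k - n \<le> v" "v \<le> k + n + 1" using v vs(2) by auto
    then have "0 < v" "0 < 2 * k + 1 - v" using Suc.prems by auto
    then obtain a b where a: "v = Suc a" and b: "2 * k + 1 - v = Suc b"
      using gr0_implies_Suc by meson
    have "2 * k + 1 - a = Suc (Suc b)" "2 * k + 1 - Suc v = b" "v - 1 = a" using a b by auto
    note e = this
    show ?thesis
      unfolding e b unfolding one_plus_X a monom_Suc_eq
      by (simp only: distrib_left distrib_right mult_1_left mult_1_right ac_simps)
  qed
  have "?X * (\<Sum>v\<leftarrow>?vs. ?g v) = (\<Sum>v\<leftarrow>vs. ?X * (?g (v - 1) + (?g v + ?g (Suc v))))"
    by (simp only: map_append sum_list_append map_map o_def sum_list_addf sum_list_const_mult distrib_left)
  also have "\<dots> = (\<Sum>v\<leftarrow>vs. (?X * [:1, 1:] + 1) * ?g v)"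
    by (rule arg_cong[of _ _ sum_list], rule map_cong[OF refl]) (rule key)
  also have "\<dots> = (?X * [:1, 1:] + 1) * (monom 1 (k - n) * [:1, 1:] * trin n)"
    unfolding sum_list_const_mult vs(3) ..
  also have "\<dots> = ?X * (monom 1 (k - Suc n) * [:1, 1:] * trin (Suc n))"
  proof -
    have "k - n = Suc (k - Suc n)" using Suc.prems by simp
    then have "monom (1::bit) (k - n) = ?X * monom 1 (k - Suc n)" by (simp only: monom_Suc_eq)
    then show ?thesis
      unfolding power_Suc by (simp only: trinomial_eq ac_simps)
  qed
  finally have "(\<Sum>v\<leftarrow>?vs. ?g v) = monom 1 (k - Suc n) * [:1, 1:] * trin (Suc n)"
    by (simp only: mult_cancel_left) simp
  moreover have "odd (length ?vs)" using vs(1) by simp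
  moreover have "set ?vs \<subseteq> {k - Suc n..k + Suc n + 1}" using vs(2) by force
  ultimately show ?case by blast
qed

text \<open>The factor 1 + X joins the last power and X^(m+1) shifts the index, which leads to
  \<open>coeff_trinomial_power_times\<close> with n = k - m - 1 and R = r - (m + 1).\<close>

lemma coeff_palindrome_eq_0:
  assumes "m < k" "k < r" "r < 2 ^ p + m"
  shows "coeff (monom 1 (m + 1) * [:1, 1:] * trin (k - m - 1) * [:1, 1:] ^ (2 ^ p + m - 1 - r)) r = 0"
proof -
  have "Suc (2 ^ p + m - 1 - r) = 2 ^ p - 1 - (r - (m + 1))" using assms by linarith
  then have e: "[:1, 1:] ^ (2 ^ p - 1 - (r - (m + 1))) = [:1, 1::bit:] * [:1, 1:] ^ (2 ^ p + m - 1 - r)"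
    unfolding power_Suc[symmetric] by (rule arg_cong[OF sym])
  have "monom 1 (m + 1) * [:1, 1:] * trin (k - m - 1) * [:1, 1:] ^ (2 ^ p + m - 1 - r)
     = monom 1 (m + 1) * (trin (k - m - 1) * [:1, 1:] ^ (2 ^ p - 1 - (r - (m + 1))))"
    unfolding e by (simp only: ac_simps)
  then have "coeff (monom 1 (m + 1) * [:1, 1:] * trin (k - m - 1) * [:1, 1:] ^ (2 ^ p + m - 1 - r)) r
     = (if r < m + 1 then 0 else coeff (trin (k - m - 1) * [:1, 1:] ^ (2 ^ p - 1 - (r - (m + 1)))) (r - (m + 1)))"
    by (simp only: coeff_monom_mult mult_1_left)
  also have "\<dots> = 0"
    using coeff_trinomial_power_times[of "k - m - 1" "r - (m + 1)" p] assms by simp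
  finally show ?thesis .
qed

text \<open>Under r = t - 2^s - j the binomial coefficients become those in the expansion of (1 + X
  (1 + X))^(m-k). The bounds on \<open>r\<close> cut off only terms that vanish, so the sum may
  first be extended to all \<open>r < t\<close>.\<close>

lemma sum_binom_coeff_single:
  fixes t p m k a :: nat and v w s
  assumes t: "t = 2 ^ p + m" and k: "2 \<le> k" "k \<le> m" "m \<le> 2 ^ p"
    and vw: "2 \<le> v" "2 \<le> w" "v + w = 2 * k + 1"
    and a: "\<And>r. a \<le> r \<longleftrightarrow> t + 2 * k + 1 \<le> 3 * r" and s: "s < p"
  defines "q \<equiv> monom 1 v + monom 1 w :: bit poly"
  shows "(\<Sum>r = a..t div 2 + k - 1. of_nat (binom (m - k) (int t - int r - 2 ^ s)) * coeff (q * [:1, 1:] ^ (t - 1 - r)) r)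
    = coeff (q * ([:0, 1:] * [:1, 1:]) ^ (2 ^ s - 1) * trin (m - k)) (t - 1)"
proof -
  let ?c = "\<lambda>r. of_nat (binom (m - k) (int t - int r - 2 ^ s)) :: bit"
  let ?T = "\<lambda>r. ?c r * coeff (q * [:1, 1:] ^ (t - 1 - r)) r"
  have s2: "2 * (2::nat) ^ s \<le> 2 ^ p"
    using s power_increasing[of "Suc s" p "2::nat"] by simp
  have binom0: "2 ^ s + r \<le> t \<and> t \<le> m - k + 2 ^ s + r" if "?c r \<noteq> 0" for r
  proof -
    have e: "int t - int r - 2 ^ s = int t - int (2 ^ s + r)" by simp
    have nz: "binom (m - k) (int t - int (2 ^ s + r)) \<noteq> 0" using that unfolding e by (metis of_nat_0)
    then have "2 ^ s + r \<le> t" unfolding binom_def by (metis diff_ge_0_iff_ge not_less of_nat_le_iff)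
    moreover from this have "binom (m - k) (int t - int (2 ^ s + r)) = (m - k) choose (t - (2 ^ s + r))"
      unfolding binom_def by (simp add: nat_diff_distrib' del: of_nat_add)
    then have "t - (2 ^ s + r) \<le> m - k" using nz by (metis binomial_eq_0 not_le)
    ultimately show ?thesis by linarith
  qed
  \<comment> \<open>Here \<open>r < t + 2 * k - 2 * r\<close> and the exponent is at least \<open>2 ^ p\<close>, so that by Frobenius
    all surviving exponents miss \<open>r\<close>; the range of \<open>r\<close> may therefore start at 0.\<close>
  have low: "coeff (monom 1 u * [:1, 1::bit:] ^ (t - 1 - r)) r = 0"
    if r: "?c r \<noteq> 0" "3 * r < t + 2 * k" and u: "2 \<le> u" "u \<le> 2 * k - 1" for r u
  proof -
    have "t \<le> m - k + 2 ^ s + r" using binom0[OF r(1)] by simp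
    then have 1: "2 ^ p + 2 * k \<le> 2 * r" using s2 k t by linarith
    then have 2: "r < m" "r < 2 ^ p" using r(2) t k by linarith+
    have "t - 1 - r = 2 ^ p + (m - 1 - r)" using 2 t by simp
    moreover have "coeff (monom 1 u * [:1, 1::bit:] ^ (2 ^ p + (m - 1 - r))) r = 0"
      by (rule coeff_monom_one_plus_X_large_eq_0) (use 1 2 k u in linarith)+
    ultimately show ?thesis by simp
  qed
  \<comment> \<open>The degree is at most \<open>2 * k - 1 + (t - 1 - r)\<close>, which is less than
    \<open>r\<close>.\<close>
  have high: "coeff (monom 1 u * [:1, 1::bit:] ^ (t - 1 - r)) r = 0"
    if "t div 2 + k - 1 < r" "r < t" and u: "2 \<le> u" "u \<le> 2 * k - 1" for r u
    by (rule coeff_monom_one_plus_X_eq_0) (use that k in linarith)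
  have vw': "v \<le> 2 * k - 1" "w \<le> 2 * k - 1" using vw by auto
  have "(\<Sum>r = a..t div 2 + k - 1. ?T r) = (\<Sum>r<t. ?T r)"
  proof (intro sum.mono_neutral_left ballI)
    have "t div 2 + k - 1 < t" using k t by linarith
    then show "{a..t div 2 + k - 1} \<subseteq> {..<t}" by auto
  next
    fix r assume r: "r \<in> {..<t} - {a..t div 2 + k - 1}"
    show "?T r = 0"
    proof (rule ccontr)
      assume "?T r \<noteq> 0"
      then have nz: "?c r \<noteq> 0" "coeff (q * [:1, 1:] ^ (t - 1 - r)) r \<noteq> 0" by auto
      have "3 * r < t + 2 * k + 1 \<or> t div 2 + k - 1 < r"
        using r a[of r] by auto
      then consider "3 * r < t + 2 * k" | "3 * r = t + 2 * k" | "t div 2 + k - 1 < r" by linarith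
      then show False
      proof cases
        case 1
        then show False
          using nz low[OF nz(1) 1 vw(1) vw'(1)] low[OF nz(1) 1 vw(2) vw'(2)]
          unfolding q_def distrib_right coeff_add by simp
      next
        case 2
        \<comment> \<open>Here \<open>t + 2 * k - 2 * r\<close> equals \<open>r\<close>, so the
          coefficient is one of a power of \<open>D_op\<close> at \<open>e2 r r\<close>, which is
          zero.\<close>
        have "2 * r = (t - 1 - r) + v + w" using 2 vw(3) k t by linarith
        then have "coeff (q * [:1, 1:] ^ (t - 1 - r)) r = coef ((D_op ^^ (t - 1 - r)) (e2 r r)) {v, w}"
          unfolding coef_D_pow_e2[OF vw(1,2)] q_def by simp
        then show False using nz(2) by (simp add: e2_def)
      next
        case 3
        have "r < t" using r by simp
        then show False
          using nz high[OF 3 _ vw(1) vw'(1)] high[OF 3 _ vw(2) vw'(2)]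
          unfolding q_def distrib_right coeff_add by simp
      qed
    qed
  qed simp
  also have "\<dots> = (\<Sum>j\<le>m - k. of_nat ((m - k) choose j) * coeff (q * [:1, 1:] ^ (2 ^ s - 1 + j)) (t - 2 ^ s - j))"
  proof -
    let ?I = "{t - 2 ^ s - (m - k)..t - 2 ^ s}"
    have st: "2 ^ s + (m - k) \<le> t" using s2 t by linarith
    have pos: "0 < (2::nat) ^ s" by simp
    have reindex: "(\<Sum>r\<in>?I. f r) = (\<Sum>j\<le>m - k. f (t - 2 ^ s - j))" for f :: "nat \<Rightarrow> bit"
      by (rule sum.reindex_bij_witness[of _ "\<lambda>j. t - 2 ^ s - j" "\<lambda>r. t - 2 ^ s - r"]) (use st in auto)
    have "(\<Sum>r<t. ?T r) = (\<Sum>r\<in>?I. ?T r)"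
    proof (intro sum.mono_neutral_right ballI)
      have "t - 2 ^ s < t" using st pos by linarith
      then show "?I \<subseteq> {..<t}" by auto
    next
      fix r assume "r \<in> {..<t} - ?I"
      then have "\<not> (2 ^ s + r \<le> t \<and> t \<le> m - k + 2 ^ s + r)" by auto
      then have "?c r = 0" using binom0[of r] by blast
      then show "?T r = 0" by (simp only: mult_zero_left)
    qed simp
    also have "\<dots> = (\<Sum>j\<le>m - k. ?T (t - 2 ^ s - j))"
      by (rule reindex)
    also have "\<dots> = (\<Sum>j\<le>m - k. of_nat ((m - k) choose j) * coeff (q * [:1, 1:] ^ (2 ^ s - 1 + j)) (t - 2 ^ s - j))"
    proof (intro sum.cong refl)
      fix j assume "j \<in> {..m - k}"
      then have j: "2 ^ s + j \<le> t" using st by simp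
      have "int t - int (t - 2 ^ s - j) - 2 ^ s = int j" using j by (simp add: of_nat_diff)
      moreover have "t - 1 - (t - 2 ^ s - j) = 2 ^ s - 1 + j" using j pos by linarith
      ultimately show "?T (t - 2 ^ s - j) = of_nat ((m - k) choose j) * coeff (q * [:1, 1:] ^ (2 ^ s - 1 + j)) (t - 2 ^ s - j)"
        by (simp only: binom_def of_nat_less_0_iff if_False nat_int)
    qed
    finally show ?thesis .
  qed
  \<comment> \<open>All \<open>j\<close> now share the coefficient index \<open>t - 1\<close>, so
    that the binomial theorem applies.\<close>
  also have "\<dots> = (\<Sum>j\<le>m - k. of_nat ((m - k) choose j) * coeff (q * ([:0, 1:] * [:1, 1:]) ^ (2 ^ s - 1 + j)) (t - 1))"
  proof (intro sum.cong refl)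
    fix j assume "j \<in> {..m - k}"
    then have "j \<le> m - k" by simp
    moreover have pos: "0 < (2::nat) ^ s" by simp
    ultimately have "\<not> t - 1 < 2 ^ s - 1 + j" "t - 1 - (2 ^ s - 1 + j) = t - 2 ^ s - j"
      using s2 t by linarith+
    then show "of_nat ((m - k) choose j) * coeff (q * [:1, 1:] ^ (2 ^ s - 1 + j)) (t - 2 ^ s - j)
      = of_nat ((m - k) choose j) * coeff (q * ([:0, 1:] * [:1, 1:]) ^ (2 ^ s - 1 + j)) (t - 1)"
      by (simp only: coeff_X_one_plus_X_power if_False)
  qed
  also have "\<dots> = coeff (\<Sum>j\<le>m - k. of_nat ((m - k) choose j) * (q * ([:0, 1:] * [:1, 1:]) ^ (2 ^ s - 1 + j))) (t - 1)"
    unfolding coeff_sum by (intro sum.cong refl) (simp add: of_nat_poly)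
  also have "(\<Sum>j\<le>m - k. of_nat ((m - k) choose j) * (q * ([:0, 1:] * [:1, 1:]) ^ (2 ^ s - 1 + j)))
    = q * ([:0, 1:] * [:1, 1:]) ^ (2 ^ s - 1) * trin (m - k)"
    unfolding trinomial_eq binomial_ring sum_distrib_left
    by (intro sum.cong refl) (simp only: power_add power_one mult_1_left mult_1_right ac_simps)
  finally show ?thesis .
qed

text \<open>Multiplied by 1 + X the sum over \<open>s\<close> telescopes to 1 + X^(2^p - 1), so the
  coefficient at \<open>t - 1\<close> is a sum of four partial sums for \<open>trin (m - k)\<close>.
  The two long ones are 1 and cancel; the two short ones are complementary.\<close>

lemma sum_binom_coeff:
  fixes t p m k a :: nat and v w
  assumes t: "t = 2 ^ p + m" and k: "2 \<le> k" "k \<le> m" "m \<le> 2 ^ p"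
    and vw: "2 \<le> v" "2 \<le> w" "v + w = 2 * k + 1"
    and a: "\<And>r. a \<le> r \<longleftrightarrow> t + 2 * k + 1 \<le> 3 * r"
  shows "(\<Sum>r = a..t div 2 + k - 1. \<Sum>s<p. of_nat (binom (m - k) (int t - int r - 2 ^ s)) *
     coeff ((monom 1 v + monom 1 w) * [:1, 1:] ^ (t - 1 - r)) r) = (1::bit)"
proof -
  let ?q = "monom 1 v + monom 1 w :: bit poly"
  let ?x = "[:0, 1::bit:]" and ?y = "[:1, 1::bit:]"
  let ?U = "?q * (\<Sum>s<p. (?x * ?y) ^ (2 ^ s - 1)) * trin (m - k)"
  have "(\<Sum>r = a..t div 2 + k - 1. \<Sum>s<p. of_nat (binom (m - k) (int t - int r - 2 ^ s)) *
     coeff (?q * [:1, 1:] ^ (t - 1 - r)) r) = (\<Sum>s<p. coeff (?q * (?x * ?y) ^ (2 ^ s - 1) * trin (m - k)) (t - 1))"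
  proof (subst sum.swap, rule sum.cong[OF refl])
    fix s assume "s \<in> {..<p}"
    then have "s < p" by simp
    from sum_binom_coeff_single[OF t k vw a this]
    show "(\<Sum>r = a..t div 2 + k - 1. of_nat (binom (m - k) (int t - int r - 2 ^ s)) * coeff (?q * [:1, 1:] ^ (t - 1 - r)) r)
      = coeff (?q * (?x * ?y) ^ (2 ^ s - 1) * trin (m - k)) (t - 1)" .
  qed
  also have "\<dots> = coeff ?U (t - 1)"
    by (simp only: sum_distrib_left sum_distrib_right coeff_sum)
  also have "\<dots> = (\<Sum>i\<le>t - 1. coeff (?q * (1 + monom 1 (2 ^ p - 1)) * trin (m - k)) i)"
  proof (rule coeff_one_plus_X_mult)
    have "?x * (?y * (\<Sum>s<p. (?x * ?y) ^ (2 ^ s - 1))) = (\<Sum>s<p. (?x * ?y) * (?x * ?y) ^ (2 ^ s - 1))"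
      by (simp only: sum_distrib_left mult.assoc)
    also have "\<dots> = (\<Sum>s<p. (?x * ?y) ^ 2 ^ s)"
      by (intro sum.cong refl) (simp only: power_Suc[symmetric] Suc_diff_1 zero_less_power zero_less_numeral)
    also have "\<dots> = ?x * (1 + monom 1 (2 ^ p - 1))"
      unfolding sum_frobenius_telescope
      by (simp only: distrib_left mult_1_right monom_Suc_eq[symmetric] Suc_diff_1 zero_less_power zero_less_numeral)
    finally have e: "?y * (\<Sum>s<p. (?x * ?y) ^ (2 ^ s - 1)) = 1 + monom 1 (2 ^ p - 1)"
      by (simp only: mult_cancel_left) simp
    have "?y * ?U = ?q * (?y * (\<Sum>s<p. (?x * ?y) ^ (2 ^ s - 1))) * trin (m - k)"
      by (simp only: ac_simps)
    then show "?y * ?U = ?q * (1 + monom 1 (2 ^ p - 1)) * trin (m - k)" unfolding e .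
  qed
  also have "?q * (1 + monom 1 (2 ^ p - 1)) * trin (m - k) =
     (monom 1 v * trin (m - k) + monom 1 w * trin (m - k)) +
     (monom 1 (v + (2 ^ p - 1)) * trin (m - k) + monom 1 (w + (2 ^ p - 1)) * trin (m - k))"
    by (simp only: distrib_left distrib_right mult_1_right mult_monom)
  also have "(\<Sum>i\<le>t - 1. coeff \<dots> i) =
     ((\<Sum>i<t - v. coeff (trin (m - k)) i) + (\<Sum>i<t - w. coeff (trin (m - k)) i)) +
     ((\<Sum>i<m + 1 - v. coeff (trin (m - k)) i) + (\<Sum>i<m + 1 - w. coeff (trin (m - k)) i))"
  proof -
    have e: "Suc (t - 1) = t" "t - (v + (2 ^ p - 1)) = m + 1 - v" "t - (w + (2 ^ p - 1)) = m + 1 - w"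
      using t k by auto
    show ?thesis
      unfolding coeff_add sum.distrib sum_coeff_monom_mult e ..
  qed
  also have "(\<Sum>i<t - v. coeff (trin (m - k)) i) = 1"
    by (rule sum_trin_ge) (use t k vw in linarith)
  also have "(\<Sum>i<t - w. coeff (trin (m - k)) i) = 1"
    by (rule sum_trin_ge) (use t k vw in linarith)
  also have "(\<Sum>i<m + 1 - v. coeff (trin (m - k)) i) + (\<Sum>i<m + 1 - w. coeff (trin (m - k)) i) = 1"
  proof -
    \<comment> \<open>If \<open>v\<close> or \<open>w\<close> exceeds \<open>m + 1\<close>,
      truncated subtraction leaves an empty sum, and the other sum runs over all
      coefficients.\<close>
    consider "v \<le> m + 1" "w \<le> m + 1" | "m + 1 < v" | "m + 1 < w" by linarith
    then show ?thesis
    proof cases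
      case 1
      then show ?thesis by (intro sum_trin_complementary) (use k vw in linarith)
    next
      case 2
      then have "2 * (m - k) < m + 1 - w" using vw k by linarith
      then show ?thesis using 2 by (simp add: sum_trin_ge)
    next
      case 3
      then have "2 * (m - k) < m + 1 - v" using vw k by linarith
      then show ?thesis using 3 by (simp add: sum_trin_ge)
    qed
  qed
  finally show ?thesis by simp
qed

section \<open>The forms \<open>F\<close> and \<open>B_form\<close>\<close>

text \<open>The forms without the generator of index 1, on which \<open>d_op\<close> is
  \<open>D_op\<close> followed by the wedge with that generator.\<close>

definition LamV :: "nat \<Rightarrow> nat \<Rightarrow> form set" where
  "LamV n q = {w. \<forall>A\<in>Poly_Mapping.keys w. A \<subseteq> {2..n} \<and> card A = q}"

lemma LamV_keysD:
  assumes "w \<in> LamV n q" "A \<in> Poly_Mapping.keys w"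
  shows "A \<subseteq> {2..n}" "card A = q" "finite A"
proof -
  show A: "A \<subseteq> {2..n}" "card A = q" using assms by (simp_all add: LamV_def)
  show "finite A" using A(1) by (rule finite_subset) simp
qed

lemma LamV_homog: "w \<in> LamV n q \<Longrightarrow> homog q w"
  unfolding homog_def using LamV_keysD by simp

lemma coef_LamV_eq_0:
  assumes "w \<in> LamV n q" "\<not> A \<subseteq> {2..n}"
  shows "coef w A = 0"
  by (rule ccontr) (use assms LamV_keysD(1)[of w n q A] in \<open>simp add: in_keys_iff\<close>)

lemma LamV_mono: "n \<le> n' \<Longrightarrow> w \<in> LamV n q \<Longrightarrow> w \<in> LamV n' q"
  unfolding LamV_def by fastforce

lemma LamV_Lam: "w \<in> LamV n q \<Longrightarrow> w \<in> Lam n q"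
  unfolding LamV_def Lam_def by fastforce

lemma LamV_zero [simp]: "0 \<in> LamV n q"
  by (simp add: LamV_def)

lemma LamV_add: "v \<in> LamV n q \<Longrightarrow> w \<in> LamV n q \<Longrightarrow> v + w \<in> LamV n q"
  using Poly_Mapping.keys_add[of v w] unfolding LamV_def by blast

lemma LamV_scale: "v \<in> LamV n q \<Longrightarrow> scale c v \<in> LamV n q"
  by (cases c) auto

lemma LamV_sum: "(\<And>x. x \<in> X \<Longrightarrow> f x \<in> LamV n q) \<Longrightarrow> (\<Sum>x\<in>X. f x) \<in> LamV n q"
  by (induction X rule: infinite_finite_induct) (auto simp: LamV_add)

lemma LamV_mon: "A \<subseteq> {2..n} \<Longrightarrow> card A = q \<Longrightarrow> mon A \<in> LamV n q"
  by (simp add: LamV_def)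

lemma LamV_D:
  assumes "w \<in> LamV n q"
  shows "D_op w \<in> LamV n q"
  unfolding LamV_def
proof (intro CollectI ballI conjI)
  fix A assume A: "A \<in> Poly_Mapping.keys (D_op w)"
  then obtain B i where B: "B \<in> Poly_Mapping.keys w" "i \<in> B" "2 < i" "A = insert (i - 1) (B - {i})"
    by (rule keys_D)
  moreover have "B \<subseteq> {2..n}" using assms B(1) by (auto simp: LamV_def)
  ultimately show "A \<subseteq> {2..n}" by fastforce
  show "card A = q" using homog_D[OF LamV_homog[OF assms]] A by (simp add: homog_def)
qed

lemma LamV_D_pow: "w \<in> LamV n q \<Longrightarrow> (D_op ^^ l) w \<in> LamV n q"
  by (induction l) (auto intro: LamV_D)

lemma LamV_e2: "x \<le> n \<Longrightarrow> y \<le> n \<Longrightarrow> e2 x y \<in> LamV n 2"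
  by (simp add: e2_def LamV_mon)

lemma D_pow_scale: "(D_op ^^ l) (scale c w) = scale c ((D_op ^^ l) w)"
  by (induction l) (auto simp: D_scale)

lemma D_pow_sum: "(D_op ^^ l) (\<Sum>x\<in>X. f x) = (\<Sum>x\<in>X. (D_op ^^ l) (f x))"
  by (induction l) (auto simp: D_sum)

lemma D_pow_e2_eq_0:
  assumes "x + y < l"
  shows "(D_op ^^ l) (e2 x y) = 0"
  by (rule D_funpow_eq_0) (use assms in \<open>auto simp: e2_def split: if_splits\<close>)

lemma scale_sum_left: "scale (\<Sum>x\<in>X. f x) w = (\<Sum>x\<in>X. scale (f x) w)"
  by (induction X rule: infinite_finite_induct) (auto simp: scale_add_left)

lemma coef_wedge_generator: "coef (w \<and>\<^sub>f mon {j}) A = (if j \<in> A then coef w (A - {j}) else 0)"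
proof (rule form_cases_sum[of w])
  fix B
  show "coef (mon B \<and>\<^sub>f mon {j}) A = (if j \<in> A then coef (mon B) (A - {j}) else 0)"
    by (auto simp: wedge_mon coef_mon)
qed (simp_all add: wedge_add_left lookup_add)

section \<open>The forms \<open>F_op (e2 x y) i\<close>\<close>

lemma F_op_e2: "F_op (e2 x y) i = (\<Sum>l\<le>x + y. (D_op ^^ l) (e2 x y) \<and>\<^sub>f mon {i + 1 + l})"
proof -
  have "{l. (D_op ^^ l) (e2 x y) \<and>\<^sub>f e_mon [i + 1 + l] \<noteq> 0} \<subseteq> {..x + y}"
    by (auto simp: D_pow_e2_eq_0 simp flip: not_less)
  then have "F_op (e2 x y) i = (\<Sum>l\<le>x + y. (D_op ^^ l) (e2 x y) \<and>\<^sub>f e_mon [i + 1 + l])"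
    unfolding F_op_def by (rule Sum_any.expand_superset[OF finite_atMost])
  then show ?thesis by (simp add: e_distinct)
qed

lemma D_generator: "3 \<le> j \<Longrightarrow> D_op (mon {j}) = mon {j - 1}"
  by (auto simp: D_mon)

lemma D_wedge:
  "homog q v \<Longrightarrow> homog r w \<Longrightarrow> D_op (v \<and>\<^sub>f w) = D_op v \<and>\<^sub>f w + v \<and>\<^sub>f D_op w"
  unfolding D_op_def by (rule derivation_wedge) (auto simp: homog_def)

text \<open>The two halves of the Leibniz rule cancel in consecutive summands.\<close>

lemma D_F_op_e2:
  assumes "2 \<le> i"
  shows "D_op (F_op (e2 x y) i) = e2 x y \<and>\<^sub>f mon {i}"
proof -
  let ?w = "\<lambda>l. (D_op ^^ l) (e2 x y)"
  have "D_op (\<Sum>l<L. ?w l \<and>\<^sub>f mon {i + 1 + l}) = e2 x y \<and>\<^sub>f mon {i} + ?w L \<and>\<^sub>f mon {i + L}" for L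
  proof (induction L)
    case (Suc L)
    have "D_op (?w L \<and>\<^sub>f mon {i + 1 + L}) = ?w (Suc L) \<and>\<^sub>f mon {i + 1 + L} + ?w L \<and>\<^sub>f D_op (mon {i + 1 + L})"
      using D_wedge[OF homog_D_pow[OF homog_e2] homog_mon] by simp
    also have "D_op (mon {i + 1 + L}) = mon {i + L}"
      using assms by (simp add: D_generator)
    finally have step: "D_op (?w L \<and>\<^sub>f mon {i + 1 + L}) = ?w (Suc L) \<and>\<^sub>f mon {i + 1 + L} + ?w L \<and>\<^sub>f mon {i + L}" .
    have "(u + v) + (u' + v) = u + u'" for u v u' :: form
      using form_cancel[of v "u + u'"] by (simp only: ac_simps)
    then show ?case
      unfolding sum.lessThan_Suc D_add Suc step by simp
  qed (simp add: form_double)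
  from this[of "Suc (x + y)"] show ?thesis
    unfolding F_op_e2 lessThan_Suc_atMost by (simp only: D_pow_e2_eq_0[OF lessI] wedge_zero add_0_right)
qed

text \<open>\<open>D_op\<close> never raises an index, so the generator of index
  \<open>r + 1 + l\<close> is the largest in its summand, and only \<open>l = c - 1 - r\<close> can
  contribute.\<close>

lemma coef_F_op_e2:
  assumes "x \<le> r" "a < b" "b < c"
  shows "coef (F_op (e2 x r) r) {a, b, c} = (if r < c then coef ((D_op ^^ (c - 1 - r)) (e2 x r)) {a, b} else 0)"
proof -
  let ?w = "\<lambda>l. (D_op ^^ l) (e2 x r)"
  have w: "?w l \<in> LamV r 2" for l
    using assms(1) by (intro LamV_D_pow LamV_e2) auto
  have *: "coef (?w l \<and>\<^sub>f mon {r + 1 + l}) {a, b, c} = (if l = c - 1 - r \<and> r < c then coef (?w (c - 1 - r)) {a, b} else 0)" for l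
  proof (cases "c = r + 1 + l")
    case True
    then have "l = c - 1 - r" "r < c" "{a, b, c} - {r + 1 + l} = {a, b}" using assms by auto
    then show ?thesis unfolding coef_wedge_generator using True by simp
  next
    case False
    have "coef (?w l) ({a, b, c} - {r + 1 + l}) = 0" if "r + 1 + l \<in> {a, b}"
      by (rule coef_LamV_eq_0[OF w]) (use that assms False in auto)
    then show ?thesis
      unfolding coef_wedge_generator using False by auto
  qed
  have "coef (F_op (e2 x r) r) {a, b, c} = (\<Sum>l\<le>x + r. if l = c - 1 - r \<and> r < c then coef (?w (c - 1 - r)) {a, b} else 0)"
    unfolding F_op_e2 coef_sum * ..
  also have "\<dots> = (if r < c \<and> c - 1 - r \<le> x + r then coef (?w (c - 1 - r)) {a, b} else 0)"
    by (cases "r < c") (simp_all add: sum.delta)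
  also have "\<dots> = (if r < c then coef (?w (c - 1 - r)) {a, b} else 0)"
    using D_pow_e2_eq_0[of x r "c - 1 - r"] by (auto simp: not_le)
  finally show ?thesis .
qed

lemma keys_F_op_e2:
  assumes "A \<in> Poly_Mapping.keys (F_op (e2 x r) i)" "2 \<le> i"
  shows "A \<subseteq> {2..} \<and> finite A \<and> card A = 3"
proof -
  from keys_sum_subset[OF assms(1)[unfolded F_op_e2]] obtain l
    where "A \<in> Poly_Mapping.keys ((D_op ^^ l) (e2 x r) \<and>\<^sub>f mon {i + 1 + l})" by blast
  then have j: "i + 1 + l \<in> A" "coef ((D_op ^^ l) (e2 x r)) (A - {i + 1 + l}) \<noteq> 0"
    by (auto simp: in_keys_iff coef_wedge_generator simp del: bit_not_zero_iff split: if_splits)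
  have "(D_op ^^ l) (e2 x r) \<in> LamV (x + r) 2"
    by (intro LamV_D_pow LamV_e2) auto
  then have B: "A - {i + 1 + l} \<subseteq> {2..x + r}" "card (A - {i + 1 + l}) = 2"
    using j(2) unfolding LamV_def in_keys_iff[symmetric] by auto
  then have fin: "finite A" using finite_subset[OF B(1)] by simp
  moreover have "card A = 3" using card.remove[OF fin j(1)] B(2) by simp
  moreover have "2 \<le> i + 1 + l"
    using assms(2) by simp
  ultimately show ?thesis using B(1) by fastforce
qed

section \<open>Kernel property and leading coefficients of \<open>B_form\<close>\<close>

abbreviation r_min :: "nat \<Rightarrow> nat \<Rightarrow> nat" where
  "r_min t k \<equiv> nat \<lceil>real (t + 2 * k + 1) / 3\<rceil>"

lemma r_min_le_iff: "r_min t k \<le> r \<longleftrightarrow> t + 2 * k + 1 \<le> 3 * r"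
proof -
  have "r_min t k \<le> r \<longleftrightarrow> real (t + 2 * k + 1) / 3 \<le> real r"
    by (rule nat_ceiling_le_eq)
  also have "\<dots> \<longleftrightarrow> real (t + 2 * k + 1) \<le> real (3 * r)"
    by (simp add: field_simps)
  finally show ?thesis by (simp only: of_nat_le_iff)
qed

definition B_coeff :: "nat \<Rightarrow> nat \<Rightarrow> nat \<Rightarrow> nat \<Rightarrow> nat \<Rightarrow> bit" where
  "B_coeff t p m k r = (\<Sum>s<p. of_nat (binom (m - k) (int t - int r - 2 ^ s)))"

lemma e_mon_pair: "2 \<le> x \<Longrightarrow> x < r \<Longrightarrow> e_mon [x, r] = e2 x r"
  by (simp add: e2_def e_distinct)

text \<open>The last equation counts weights: \<open>t - 1 - r\<close> applications of
  \<open>D_op\<close> take the pair down to weight \<open>2 * k + 1\<close>, that of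
  \<open>z\<^sub>k\<close>.\<close>

lemma B_range:
  assumes "r \<in> {r_min t k..t div 2 + k - 1}" "2 \<le> k" "2 * k \<le> t"
  shows "2 \<le> t + 2 * k - 2 * r" "t + 2 * k - 2 * r < r" "r < t" "t + 2 * k - 2 * r + r = (t - 1 - r) + (2 * k + 1)"
proof -
  have r: "t + 2 * k + 1 \<le> 3 * r" "r \<le> t div 2 + k - 1"
    using assms(1) r_min_le_iff[of t k r] by auto
  then have "2 * r + 2 \<le> t + 2 * k" using assms(2) by linarith
  then show "2 \<le> t + 2 * k - 2 * r" "t + 2 * k - 2 * r < r" "r < t"
    "t + 2 * k - 2 * r + r = (t - 1 - r) + (2 * k + 1)"
    using r(1) assms(2,3) by linarith+
qed

lemma B_form_eq:
  assumes "2 \<le> k" "2 * k \<le> t"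
  shows "B_form t p m k =
    (\<Sum>r = r_min t k..t div 2 + k - 1. scale (B_coeff t p m k r) (F_op (e2 (t + 2 * k - 2 * r) r) r))"
  unfolding B_form_def
proof (rule sum.cong[OF refl])
  fix r assume r: "r \<in> {r_min t k..t div 2 + k - 1}"
  show "(\<Sum>s<p. scale (of_nat (binom (m - k) (int t - int r - 2 ^ s))) (F_op (e_mon [t + 2 * k - 2 * r, r]) r))
    = scale (B_coeff t p m k r) (F_op (e2 (t + 2 * k - 2 * r) r) r)"
    unfolding B_coeff_def scale_sum_left e_mon_pair[OF B_range(1,2)[OF r assms]] ..
qed

text \<open>By \<open>D_F_op_e2\<close> each summand contributes the wedge of e^x e^r with e^r,
  which repeats an index.\<close>

lemma D_B_form:
  assumes "2 \<le> k" "2 * k \<le> t"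
  shows "D_op (B_form t p m k) = 0"
  unfolding B_form_eq[OF assms] D_sum D_scale
proof (rule sum.neutral, rule ballI)
  fix r assume r: "r \<in> {r_min t k..t div 2 + k - 1}"
  have "e2 (t + 2 * k - 2 * r) r \<and>\<^sub>f mon {r} = 0"
    by (simp add: e2_def wedge_mon)
  then show "scale (B_coeff t p m k r) (D_op (F_op (e2 (t + 2 * k - 2 * r) r) r)) = 0"
    using B_range(1,2)[OF r assms] by (simp add: D_F_op_e2)
qed

text \<open>The coefficient of the generator with index \<open>t\<close> in \<open>B_form t p m k\<close>.\<close>

definition B_top :: "nat \<Rightarrow> nat \<Rightarrow> nat \<Rightarrow> nat \<Rightarrow> form" where
  "B_top t p m k = (\<Sum>r = r_min t k..t div 2 + k - 1.
     scale (B_coeff t p m k r) ((D_op ^^ (t - 1 - r)) (e2 (t + 2 * k - 2 * r) r)))"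

lemma homog_B_top: "homog 2 (B_top t p m k)"
  unfolding B_top_def by (intro homog_sum homog_scale homog_D_pow homog_e2)

text \<open>Identifies \<open>B_top t p m k\<close> with \<open>z\<^sub>k\<close>. Weights force the
  sum of the two indices, and \<open>sum_binom_coeff\<close> evaluates the rest.\<close>

lemma coef_B_top:
  assumes t: "t = 2 ^ p + m" and k: "2 \<le> k" "k \<le> m" "m \<le> 2 ^ p" and vw: "2 \<le> v" "2 \<le> w"
  shows "coef (B_top t p m k) {v, w} = of_bool (v + w = 2 * k + 1)"
proof -
  have kt: "2 * k \<le> t" using t k by linarith
  have "coef (B_top t p m k) {v, w} = (\<Sum>r = r_min t k..t div 2 + k - 1. B_coeff t p m k r *
    (if v + w = 2 * k + 1 then coeff ((monom 1 v + monom 1 w) * [:1, 1:] ^ (t - 1 - r)) r else 0))"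
    unfolding B_top_def coef_sum lookup_scale
  proof (rule sum.cong[OF refl])
    fix r assume r: "r \<in> {r_min t k..t div 2 + k - 1}"
    have "t + 2 * k - 2 * r + r = t - 1 - r + v + w \<longleftrightarrow> v + w = 2 * k + 1"
      using B_range(4)[OF r k(1) kt] by linarith
    then show "B_coeff t p m k r * coef ((D_op ^^ (t - 1 - r)) (e2 (t + 2 * k - 2 * r) r)) {v, w} =
      B_coeff t p m k r * (if v + w = 2 * k + 1 then coeff ((monom 1 v + monom 1 w) * [:1, 1:] ^ (t - 1 - r)) r else 0)"
      unfolding coef_D_pow_e2[OF vw] by simp
  qed
  also have "\<dots> = of_bool (v + w = 2 * k + 1)"
  proof (cases "v + w = 2 * k + 1")
    case True
    have "(\<Sum>r = r_min t k..t div 2 + k - 1. B_coeff t p m k r * coeff ((monom 1 v + monom 1 w) * [:1, 1:] ^ (t - 1 - r)) r)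
      = (\<Sum>r = r_min t k..t div 2 + k - 1. \<Sum>s<p. of_nat (binom (m - k) (int t - int r - 2 ^ s)) *
         coeff ((monom 1 v + monom 1 w) * [:1, 1:] ^ (t - 1 - r)) r)"
      unfolding B_coeff_def sum_distrib_right ..
    also have "\<dots> = 1"
      by (rule sum_binom_coeff[OF t k vw True r_min_le_iff])
    finally show ?thesis using True by simp
  qed simp
  finally show ?thesis .
qed

text \<open>The coefficients of \<open>B_top t p m k\<close> depend only on the sum of the two
  indices, so the two terms of \<open>coef_D2\<close> cancel.\<close>

lemma coef_D_pow_B_top:
  assumes t: "t = 2 ^ p + m" and k: "2 \<le> k" "k \<le> m" "m \<le> 2 ^ p" and vw: "2 \<le> v" "2 \<le> w"
  shows "coef ((D_op ^^ Suc l) (B_top t p m k)) {v, w} = 0"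
  using vw
proof (induction l arbitrary: v w)
  case 0
  then show ?case
    using coef_D2[OF homog_B_top 0] coef_B_top[OF t k, of "Suc v" w] coef_B_top[OF t k, of v "Suc w"] by simp
next
  case (Suc l)
  then show ?case
    using coef_D2[OF homog_D_pow[OF homog_B_top, of "Suc l"] Suc.prems] Suc.IH[of "Suc v" w] Suc.IH[of v "Suc w"]
    by simp
qed

text \<open>All \<open>r\<close> in the range lie below \<open>t\<close>, so every summand
  contributes at \<open>c\<close>, and \<open>c - 1 - r\<close> splits as
  \<open>(c - t) + (t - 1 - r)\<close>.\<close>

lemma coef_B_form:
  assumes k: "2 \<le> k" "2 * k \<le> t" and "a < b" "b < c" "t \<le> c"
  shows "coef (B_form t p m k) {a, b, c} = coef ((D_op ^^ (c - t)) (B_top t p m k)) {a, b}"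
  unfolding B_form_eq[OF k] B_top_def D_pow_sum coef_sum D_pow_scale lookup_scale
proof (rule sum.cong[OF refl])
  fix r assume r: "r \<in> {r_min t k..t div 2 + k - 1}"
  note B = B_range[OF r k]
  have "(c - t) + (t - 1 - r) = c - 1 - r" using B(3) assms(5) by linarith
  then have "(D_op ^^ (c - t)) ((D_op ^^ (t - 1 - r)) (e2 (t + 2 * k - 2 * r) r)) = (D_op ^^ (c - 1 - r)) (e2 (t + 2 * k - 2 * r) r)"
    by (metis comp_apply funpow_add)
  then show "B_coeff t p m k r * coef (F_op (e2 (t + 2 * k - 2 * r) r) r) {a, b, c} =
    B_coeff t p m k r * coef ((D_op ^^ (c - t)) ((D_op ^^ (t - 1 - r)) (e2 (t + 2 * k - 2 * r) r))) {a, b}"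
    using B coef_F_op_e2[of "t + 2 * k - 2 * r" r a b c] assms by simp
qed

lemma keys_B_form:
  assumes k: "2 \<le> k" "2 * k \<le> t" and A: "A \<in> Poly_Mapping.keys (B_form t p m k)"
  shows "A \<subseteq> {2..} \<and> finite A \<and> card A = 3"
proof -
  from keys_sum_subset[OF A[unfolded B_form_eq[OF k]]] obtain r
    where r: "r \<in> {r_min t k..t div 2 + k - 1}"
      "A \<in> Poly_Mapping.keys (scale (B_coeff t p m k r) (F_op (e2 (t + 2 * k - 2 * r) r) r))" by blast
  then have "A \<in> Poly_Mapping.keys (F_op (e2 (t + 2 * k - 2 * r) r) r)"
    by (cases "B_coeff t p m k r") auto
  then show ?thesis using keys_F_op_e2 B_range(1,2)[OF r(1) k] by simp
qed

lemma card_3_nat_cases: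
  fixes A :: "nat set"
  assumes "card A = 3"
  obtains a b c where "a < b" "b < c" "A = {a, b, c}"
proof -
  obtain x y z where xyz: "A = {x, y, z}" "x \<noteq> y" "x \<noteq> z" "y \<noteq> z"
    using assms by (auto simp: card_3_iff)
  then consider "x < y" "y < z" | "x < z" "z < y" | "y < x" "x < z" | "y < z" "z < x" | "z < x" "x < y" | "z < y" "y < x"
    by linarith
  then show thesis
    by cases (rule that, assumption, assumption, use xyz(1) in auto)+
qed

text \<open>A largest index beyond \<open>t\<close> would bring in a positive power of
  \<open>D_op\<close> at \<open>B_top t p m k\<close>, whose coefficients are zero.\<close>

lemma B_form_LamV:
  assumes t: "t = 2 ^ p + m" and k: "2 \<le> k" "k \<le> m" "m \<le> 2 ^ p"
  shows "B_form t p m k \<in> LamV t 3"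
  unfolding LamV_def
proof (rule CollectI, rule ballI)
  have kt: "2 * k \<le> t" using t k by linarith
  fix A assume A: "A \<in> Poly_Mapping.keys (B_form t p m k)"
  note K = keys_B_form[OF k(1) kt A]
  then obtain a b c where abc: "a < b" "b < c" "A = {a, b, c}" using card_3_nat_cases by blast
  have "c \<le> t"
  proof (rule ccontr)
    assume "\<not> c \<le> t"
    then obtain l where l: "c - t = Suc l" "t \<le> c" by (metis Suc_diff_Suc le_cases not_le)
    have "2 \<le> a" "2 \<le> b" using K abc by auto
    then have "coef (B_form t p m k) A = 0"
      unfolding abc(3) coef_B_form[OF k(1) kt abc(1,2) l(2)] l(1) by (rule coef_D_pow_B_top[OF t k])
    then show False using A by (simp add: in_keys_iff)
  qed
  then show "A \<subseteq> {2..t} \<and> card A = 3" using K abc by auto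
qed

text \<open>\<open>{k, Suc k}\<close> is the only consecutive pair of weight
  \<open>2 * k + 1\<close>. For fixed \<open>t\<close> these pivots form an identity matrix, which
  serves both spanning and independence.\<close>

lemma coef_B_form_pivot:
  assumes t: "t = 2 ^ p + m" and k: "2 \<le> k" "k \<le> m" "m \<le> 2 ^ p" and j: "2 \<le> j" "Suc j < t"
  shows "coef (B_form t p m k) {j, Suc j, t} = of_bool (j = k)"
proof -
  have kt: "2 * k \<le> t" using t k by linarith
  have "coef (B_form t p m k) {j, Suc j, t} = coef (B_top t p m k) {j, Suc j}"
    using coef_B_form[OF k(1) kt, of j "Suc j" t] j by simp
  also have "\<dots> = of_bool (j + Suc j = 2 * k + 1)"
    using j by (intro coef_B_top[OF t k]) auto
  also have "j + Suc j = 2 * k + 1 \<longleftrightarrow> j = k" by auto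
  finally show ?thesis .
qed

section \<open>The kernel of \<open>D\<close> on 3-forms\<close>

text \<open>For \<open>w\<close> in the kernel of \<open>D\<close> this is the coefficient of the generator with index \<open>c\<close> in the part
  of \<open>w\<close> with largest index \<open>c\<close>; it is determined by the coefficients of \<open>w\<close> at \<open>{i, r, r + 1}\<close>.\<close>

definition top_part :: "form \<Rightarrow> nat \<Rightarrow> form" where
  "top_part w c = (\<Sum>r<c. \<Sum>i = 2..<r. scale (coef w {i, r, Suc r}) ((D_op ^^ (c - 1 - r)) (e2 i r)))"

lemma top_part_Suc:
  "top_part w (Suc c) = D_op (top_part w c) + (\<Sum>i = 2..<c. scale (coef w {i, c, Suc c}) (e2 i c))"
proof -
  have "(\<Sum>r<c. \<Sum>i = 2..<r. scale (coef w {i, r, Suc r}) ((D_op ^^ (Suc c - 1 - r)) (e2 i r))) = D_op (top_part w c)"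
    unfolding top_part_def D_sum D_scale
  proof (intro sum.cong refl)
    fix r i assume "r \<in> {..<c}"
    then have "Suc c - 1 - r = Suc (c - 1 - r)" by auto
    then show "scale (coef w {i, r, Suc r}) ((D_op ^^ (Suc c - 1 - r)) (e2 i r)) =
      scale (coef w {i, r, Suc r}) (D_op ((D_op ^^ (c - 1 - r)) (e2 i r)))" by simp
  qed
  then show ?thesis
    unfolding top_part_def[of w "Suc c"] sum.lessThan_Suc by simp
qed

lemma top_part_LamV: "top_part w c \<in> LamV (c - 1) 2"
  unfolding top_part_def by (intro LamV_sum LamV_scale LamV_D_pow LamV_e2) auto

text \<open>\<open>coef_D3\<close> expresses the coefficients with largest index
  \<open>Suc c\<close> by those with \<open>c\<close>, which is the recursion of
  \<open>top_part_Suc\<close>. Only the coefficients with \<open>b = c\<close> are free, and they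
  enter as the new summands.\<close>

lemma coef_top_part:
  assumes w: "homog 3 w" "D_op w = 0" and ab: "2 \<le> a" "a < b" "b < c"
  shows "coef w {a, b, c} = coef (top_part w c) {a, b}"
  using ab
proof (induction c arbitrary: a b)
  case (Suc c)
  have hom: "homog 2 (top_part w c)" by (rule LamV_homog[OF top_part_LamV])
  \<comment> \<open>When a raised index collides with the next one, the set becomes too small and
    its coefficient is zero.\<close>
  have small: "coef (top_part w c) {x} = 0" for x
    by (rule coef_homog_eq_0[OF hom]) simp
  have small3: "coef w {x, y} = 0" for x y
    by (rule coef_homog_eq_0[OF w(1)]) (simp add: card_insert_if)
  have high: "coef (top_part w c) {x, c} = 0" if "2 \<le> x" for x
    by (rule coef_LamV_eq_0[OF top_part_LamV]) (use that Suc.prems in auto)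
  show ?case
  proof (cases "b = c")
    case True
    have "coef (top_part w (Suc c)) {a, c} = coef (D_op (top_part w c)) {a, c}
       + (\<Sum>i = 2..<c. coef w {i, c, Suc c} * of_bool (i = a))"
    proof -
      have "coef (e2 i c) {a, c} = of_bool (i = a)" if "i \<in> {2..<c}" for i
        using that Suc.prems True by (auto simp: e2_def coef_mon doubleton_eq_iff)
      then show ?thesis
        unfolding top_part_Suc lookup_add coef_sum lookup_scale by simp
    qed
    also have "coef (D_op (top_part w c)) {a, c} = 0"
      by (rule coef_LamV_eq_0[OF LamV_D[OF top_part_LamV]]) (use Suc.prems in auto)
    also have "(\<Sum>i = 2..<c. coef w {i, c, Suc c} * of_bool (i = a)) = coef w {a, c, Suc c}"
      using Suc.prems True by (simp add: of_bool_def if_distrib sum.delta cong: if_cong)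
    finally show ?thesis using True by simp
  next
    case False
    then have b: "b < c" using Suc.prems by simp
    have "coef (D_op w) {a, b, c} = coef w {Suc a, b, c} + coef w {a, Suc b, c} + coef w {a, b, Suc c}"
      by (rule coef_D3[OF w(1)]) (use Suc.prems b in auto)
    then have "coef w {a, b, Suc c} = coef w {Suc a, b, c} + coef w {a, Suc b, c}"
      using w(2) by (simp add: bit_add_eq_0_iff)
    also have "coef w {Suc a, b, c} = coef (top_part w c) {Suc a, b}"
    proof (cases "Suc a = b")
      case True
      then show ?thesis using small small3 by simp
    next
      case False
      then show ?thesis using Suc.prems b by (intro Suc.IH) auto
    qed
    also have "coef w {a, Suc b, c} = coef (top_part w c) {a, Suc b}"
    proof (cases "Suc b = c")
      case True
      then show ?thesis using high[OF Suc.prems(1)] small3 by simp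
    next
      case False
      then show ?thesis using Suc.prems b by (intro Suc.IH) auto
    qed
    also have "coef (top_part w c) {Suc a, b} + coef (top_part w c) {a, Suc b} = coef (D_op (top_part w c)) {a, b}"
      by (rule coef_D2[OF hom, symmetric]) (use Suc.prems in auto)
    also have "\<dots> = coef (top_part w (Suc c)) {a, b}"
    proof -
      have "coef (e2 i c) {a, b} = 0" for i
        using Suc.prems b by (auto simp: e2_def coef_mon doubleton_eq_iff)
      then show ?thesis
        unfolding top_part_Suc lookup_add coef_sum lookup_scale by simp
    qed
    finally show ?thesis .
  qed
qed simp

text \<open>Raising the largest index \<open>t\<close> leads out of \<open>LamV t 3\<close>, so the
  equation \<open>D_op w = 0\<close> at \<open>{a, b, t}\<close> has two terms left.\<close>

lemma coef_kernel_shift: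
  assumes w: "w \<in> LamV t 3" "D_op w = 0" and ab: "2 \<le> a" "2 \<le> b" "a < t" "b < t" "a \<noteq> b"
  shows "coef w {Suc a, b, t} = coef w {a, Suc b, t}"
proof -
  have "coef (D_op w) {a, b, t} = coef w {Suc a, b, t} + coef w {a, Suc b, t} + coef w {a, b, Suc t}"
    by (rule coef_D3[OF LamV_homog[OF w(1)]]) (use ab in auto)
  moreover have "coef w {a, b, Suc t} = 0"
    by (rule coef_LamV_eq_0[OF w(1)]) auto
  ultimately show ?thesis using w(2) by (simp add: bit_add_eq_0_iff)
qed

text \<open>Iterates the shift along the pairs of weight \<open>2 * k + 1\<close>. The bound lets
  the partner index reach \<open>t\<close> itself, where the set degenerates.\<close>

lemma coef_kernel_const:
  assumes w: "w \<in> LamV t 3" "D_op w = 0" and v: "2 \<le> v" "v \<le> k" "2 * k < t + v"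
  shows "coef w {v, 2 * k + 1 - v, t} = coef w {k, Suc k, t}"
  using v
proof (induction "k - v" arbitrary: v)
  case 0
  then have "v = k" "2 * k + 1 - v = Suc k" by auto
  then show ?case by simp
next
  case (Suc d)
  have "coef w {Suc v, 2 * k - v, t} = coef w {v, Suc (2 * k - v), t}"
    by (rule coef_kernel_shift[OF w]) (use Suc in auto)
  moreover have "coef w {Suc v, 2 * k + 1 - Suc v, t} = coef w {k, Suc k, t}"
    by (rule Suc.hyps) (use Suc in auto)
  moreover have "Suc (2 * k - v) = 2 * k + 1 - v" "2 * k + 1 - Suc v = 2 * k - v" using Suc by auto
  ultimately show ?case by simp
qed

text \<open>The shift moves a pair inwards until its indices are consecutive, where \<open>z\<close>
  applies, or meet, where the set is too small.\<close>

lemma coef_kernel_zero: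
  assumes w: "w \<in> LamV t 3" "D_op w = 0" and z: "\<And>k. 2 \<le> k \<Longrightarrow> Suc k < t \<Longrightarrow> coef w {k, Suc k, t} = 0"
    and ab: "2 \<le> a" "a < b" "b < t"
  shows "coef w {a, b, t} = 0"
  using ab
proof (induction "b - a" arbitrary: a b rule: less_induct)
  case less
  have small: "coef w {x, y} = 0" for x y
    by (rule coef_homog_eq_0[OF LamV_homog[OF w(1)]]) (simp add: card_insert_if)
  show ?case
  proof (cases "b = Suc a")
    case True
    then show ?thesis using z less.prems by simp
  next
    case False
    have "coef w {Suc a, b - 1, t} = coef w {a, Suc (b - 1), t}"
      by (rule coef_kernel_shift[OF w]) (use less.prems False in auto)
    moreover have "coef w {Suc a, b - 1, t} = 0"
    proof (cases "b - 1 = Suc a")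
      case True
      then show ?thesis using small by simp
    next
      case False
      then show ?thesis using less.prems \<open>b \<noteq> Suc a\<close> by (intro less.hyps) auto
    qed
    ultimately show ?thesis using less.prems by simp
  qed
qed

lemma LamV_pred:
  assumes w: "w \<in> LamV (Suc t) 3" and z: "\<And>a b. 2 \<le> a \<Longrightarrow> a < b \<Longrightarrow> b < Suc t \<Longrightarrow> coef w {a, b, Suc t} = 0"
  shows "w \<in> LamV t 3"
  unfolding LamV_def
proof (rule CollectI, rule ballI)
  fix A assume A: "A \<in> Poly_Mapping.keys w"
  note K = LamV_keysD[OF w A]
  obtain a b c where abc: "a < b" "b < c" "A = {a, b, c}" using card_3_nat_cases[OF K(2)] .
  have "c \<noteq> Suc t"
  proof
    assume "c = Suc t"
    then have "coef w A = 0" using z[of a b] abc K(1) by simp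
    then show False using A by (simp add: in_keys_iff)
  qed
  then show "A \<subseteq> {2..t} \<and> card A = 3" using K abc by auto
qed

lemma sum_list_bit_const: "(\<Sum>x\<leftarrow>xs. b) = (if odd (length xs) then b else (0::bit))"
  by (induction xs) auto

lemma sum_list_sum_swap: "(\<Sum>x\<leftarrow>xs. \<Sum>y\<in>Y. f x y) = (\<Sum>y\<in>Y. \<Sum>x\<leftarrow>xs. f x y)" for f :: "'a \<Rightarrow> 'b \<Rightarrow> 'c::comm_monoid_add"
  by (induction xs) (simp_all add: sum.distrib)

lemma coeff_sum_list: "coeff (\<Sum>x\<leftarrow>xs. f x) n = (\<Sum>x\<leftarrow>xs. coeff (f x) n)"
  by (induction xs) simp_all

text \<open>The functional on the top part that pairs with an odd palindrome kills every
  summand of the top part, while the coefficients it adds up are all equal.\<close>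

lemma coef_kernel_pivot_eq_0:
  assumes w: "w \<in> LamV t 3" "D_op w = 0" and t: "t = 2 ^ p + m" "0 < m" and k: "m < k" "2 \<le> k" "Suc k < t"
  shows "coef w {k, Suc k, t} = 0"
proof (cases "2 * k \<le> t")
  case False
  have small: "coef w {x, y} = 0" for x y
    by (rule coef_homog_eq_0[OF LamV_homog[OF w(1)]]) (simp add: card_insert_if)
  \<comment> \<open>Followed outwards, the pairs of weight \<open>2 * k + 1\<close> reach the
    partner index \<open>t\<close>, and the set has only two elements.\<close>
  have "coef w {2 * k + 1 - t, 2 * k + 1 - (2 * k + 1 - t), t} = coef w {k, Suc k, t}"
    by (rule coef_kernel_const[OF w]) (use False k in auto)
  moreover have "2 * k + 1 - (2 * k + 1 - t) = t" using False by simp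
  ultimately show ?thesis using small by simp
next
  case True
  \<comment> \<open>With this choice the palindrome starts at X^(m+1), as in
    \<open>coeff_palindrome_eq_0\<close>.\<close>
  define n where "n = k - m - 1"
  have nk: "Suc n < k" using k t(2) unfolding n_def by auto
  obtain vs where vs: "odd (length vs)" "set vs \<subseteq> {k - n..k + n + 1}"
    "(\<Sum>v\<leftarrow>vs. monom 1 v + monom 1 (2 * k + 1 - v)) = monom 1 (k - n) * [:1, 1:] * trin n"
    using odd_palindrome_basis[OF nk] by blast
  have n: "k - n = m + 1" using k unfolding n_def by simp
  have range: "2 \<le> v" "v \<le> 2 * k - 1" if "v \<in> set vs" for v
  proof -
    have "k - n \<le> v" "v \<le> k + n + 1" using that vs(2) by auto
    then show "2 \<le> v" "v \<le> 2 * k - 1" using nk by linarith+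
  qed
  have top: "coef w {k, Suc k, t} = coef (top_part w t) {v, 2 * k + 1 - v}" if v: "v \<in> set vs" for v
  proof (cases "v \<le> k")
    case le: True
    have "coef w {v, 2 * k + 1 - v, t} = coef w {k, Suc k, t}"
      by (rule coef_kernel_const[OF w]) (use range[OF v] le True in auto)
    moreover have "coef w {v, 2 * k + 1 - v, t} = coef (top_part w t) {v, 2 * k + 1 - v}"
      by (rule coef_top_part[OF LamV_homog[OF w(1)] w(2)]) (use range[OF v] le True k in auto)
    ultimately show ?thesis by simp
  next
    case gt: False
    define u where "u = 2 * k + 1 - v"
    have u: "2 \<le> u" "u \<le> k" "v = 2 * k + 1 - u" using range[OF v] gt unfolding u_def by auto
    have "coef w {u, 2 * k + 1 - u, t} = coef w {k, Suc k, t}"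
      by (rule coef_kernel_const[OF w]) (use u True k in auto)
    moreover have "coef w {u, 2 * k + 1 - u, t} = coef (top_part w t) {u, 2 * k + 1 - u}"
      by (rule coef_top_part[OF LamV_homog[OF w(1)] w(2)]) (use u True k in auto)
    ultimately show ?thesis unfolding u_def[symmetric] u(3)[symmetric] by (simp add: insert_commute)
  qed
  have zero: "(\<Sum>v\<leftarrow>vs. coef ((D_op ^^ (t - 1 - r)) (e2 i r)) {v, 2 * k + 1 - v}) = 0"
    if r: "r < t" "i < r" for r i
  proof -
    have "(\<Sum>v\<leftarrow>vs. coef ((D_op ^^ (t - 1 - r)) (e2 i r)) {v, 2 * k + 1 - v}) =
      (\<Sum>v\<leftarrow>vs. if i + r = t - 1 - r + (2 * k + 1)
         then coeff ((monom 1 v + monom 1 (2 * k + 1 - v)) * [:1, 1:] ^ (t - 1 - r)) r else 0)"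
    proof (rule arg_cong[of _ _ sum_list], rule map_cong[OF refl])
      fix v assume v: "v \<in> set vs"
      have "2 \<le> v" "2 \<le> 2 * k + 1 - v" "t - 1 - r + v + (2 * k + 1 - v) = t - 1 - r + (2 * k + 1)"
        using range[OF v] by auto
      then show "coef ((D_op ^^ (t - 1 - r)) (e2 i r)) {v, 2 * k + 1 - v} = (if i + r = t - 1 - r + (2 * k + 1)
         then coeff ((monom 1 v + monom 1 (2 * k + 1 - v)) * [:1, 1:] ^ (t - 1 - r)) r else 0)"
        by (simp only: coef_D_pow_e2)
    qed
    also have "\<dots> = 0"
    proof (cases "i + r = t - 1 - r + (2 * k + 1)")
      case eq: True
      \<comment> \<open>From \<open>i < r\<close> and \<open>2 * k \<le> t\<close> the equation of
        weights gives \<open>3 * r > t + 2 * k \<ge> 4 * k\<close>.\<close>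
      have "k < r" using eq r True k by linarith
      have "(\<Sum>v\<leftarrow>vs. coeff ((monom (1::bit) v + monom 1 (2 * k + 1 - v)) * [:1, 1:] ^ (t - 1 - r)) r)
        = coeff ((\<Sum>v\<leftarrow>vs. monom 1 v + monom 1 (2 * k + 1 - v)) * [:1, 1:] ^ (t - 1 - r)) r"
        unfolding sum_list_mult_const[symmetric] coeff_sum_list ..
      also have "\<dots> = 0"
        unfolding vs(3) n unfolding n_def t(1)
        by (rule coeff_palindrome_eq_0) (use k \<open>k < r\<close> r t in auto)
      finally show ?thesis using eq by simp
    qed simp
    finally show ?thesis .
  qed
  have "coef w {k, Suc k, t} = (\<Sum>v\<leftarrow>vs. coef w {k, Suc k, t})"
    using vs(1) by (simp add: sum_list_bit_const)
  also have "\<dots> = (\<Sum>v\<leftarrow>vs. coef (top_part w t) {v, 2 * k + 1 - v})"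
    by (rule arg_cong[of _ _ sum_list], rule map_cong[OF refl]) (rule top)
  also have "\<dots> = (\<Sum>r<t. \<Sum>i = 2..<r. coef w {i, r, Suc r} *
      (\<Sum>v\<leftarrow>vs. coef ((D_op ^^ (t - 1 - r)) (e2 i r)) {v, 2 * k + 1 - v}))"
    unfolding top_part_def coef_sum lookup_scale sum_list_sum_swap sum_list_const_mult ..
  also have "\<dots> = 0"
  proof (intro sum.neutral ballI)
    fix r i assume "r \<in> {..<t}" "i \<in> {2..<r}"
    then show "coef w {i, r, Suc r} * (\<Sum>v\<leftarrow>vs. coef ((D_op ^^ (t - 1 - r)) (e2 i r)) {v, 2 * k + 1 - v}) = 0"
      using zero[of r i] by (simp only: lessThan_iff atLeastLessThan_iff mult_zero_right)
  qed
  finally show ?thesis .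
qed

section \<open>The forms in the sets \<open>B_set t\<close> as a basis of the kernel\<close>

definition subset_sums :: "form set \<Rightarrow> form set" where
  "subset_sums G = {\<Sum>X | X. X \<subseteq> G \<and> finite X}"

lemma subset_sums_zero: "0 \<in> subset_sums G"
  unfolding subset_sums_def by (intro CollectI exI[of _ "{}"]) simp

lemma subset_sums_mem: "g \<in> G \<Longrightarrow> g \<in> subset_sums G"
  unfolding subset_sums_def by (intro CollectI exI[of _ "{g}"]) simp

lemma subset_sums_mono: "G \<subseteq> H \<Longrightarrow> subset_sums G \<subseteq> subset_sums H"
  unfolding subset_sums_def by blast

text \<open>Common elements cancel, so the sum is taken over the symmetric difference.\<close>

lemma subset_sums_add:
  assumes "x \<in> subset_sums G" "y \<in> subset_sums G"
  shows "x + y \<in> subset_sums G"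
proof -
  obtain X Y where X: "X \<subseteq> G" "finite X" "x = \<Sum>X" and Y: "Y \<subseteq> G" "finite Y" "y = \<Sum>Y"
    using assms unfolding subset_sums_def by blast
  have "x = \<Sum>(X \<inter> Y) + \<Sum>(X - Y)" "y = \<Sum>(X \<inter> Y) + \<Sum>(Y - X)"
    using sum.Int_Diff[OF X(2), of "\<lambda>x. x" Y] sum.Int_Diff[OF Y(2), of "\<lambda>x. x" X] X(3) Y(3)
    by (simp_all add: Int_commute)
  then have "x + y = \<Sum>(X - Y) + \<Sum>(Y - X)"
    using form_cancel[of "\<Sum>(X \<inter> Y)" "\<Sum>(X - Y) + \<Sum>(Y - X)"] by (simp only: ac_simps)
  also have "\<dots> = \<Sum>((X - Y) \<union> (Y - X))"
    using X(2) Y(2) by (intro sum.union_disjoint[symmetric]) auto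
  finally have "x + y = \<Sum>((X - Y) \<union> (Y - X))" .
  moreover have "(X - Y) \<union> (Y - X) \<subseteq> G" "finite ((X - Y) \<union> (Y - X))" using X Y by auto
  ultimately show ?thesis unfolding subset_sums_def by blast
qed

lemma subset_sums_sum: "(\<And>i. i \<in> I \<Longrightarrow> f i \<in> subset_sums G) \<Longrightarrow> (\<Sum>i\<in>I. f i) \<in> subset_sums G"
  by (induction I rule: infinite_finite_induct) (auto simp: subset_sums_zero subset_sums_add)

lemma pm_unique:
  assumes "2 ^ p + m = (2 ^ p' + m' :: nat)" "0 < m" "m \<le> 2 ^ p" "0 < m'" "m' \<le> 2 ^ p'"
  shows "p' = p" "m' = m"
proof -
  let ?P = "\<lambda>(q, l). 2 ^ p + m = 2 ^ q + l \<and> 0 < l \<and> l \<le> (2::nat) ^ q"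
  have "2 \<le> 2 ^ p + m" using assms(2) one_le_power[of "2::nat" p] by linarith
  from ex1_pm[OF this] obtain x where "\<And>y. ?P y \<Longrightarrow> y = x"
    unfolding Ex1_def by blast
  from this[of "(p, m)"] this[of "(p', m')"] show "p' = p" "m' = m" using assms by simp_all
qed

lemma B_set_eq:
  assumes "t = 2 ^ p + m" "0 < m" "m \<le> 2 ^ p"
  shows "B_set t = B_form t p m ` {2..m}"
proof
  show "B_form t p m ` {2..m} \<subseteq> B_set t"
  proof (rule image_subsetI)
    fix k assume "k \<in> {2..m}"
    then show "B_form t p m k \<in> B_set t"
      using assms unfolding B_set_def by (intro CollectI exI[of _ p] exI[of _ m] exI[of _ k]) simp
  qed
  show "B_set t \<subseteq> B_form t p m ` {2..m}"
  proof
    fix w assume "w \<in> B_set t"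
    then obtain p' m' k where *: "w = B_form t p' m' k" "t = 2 ^ p' + m'" "0 < m'" "m' \<le> 2 ^ p'" "2 \<le> k" "k \<le> m'"
      unfolding B_set_def by blast
    have "p' = p" "m' = m" using pm_unique[of p m p' m'] assms * by simp_all
    then show "w \<in> B_form t p m ` {2..m}" using * by simp
  qed
qed

lemma obtain_pm:
  assumes "2 \<le> t"
  obtains p m where "t = 2 ^ p + m" "0 < m" "m \<le> (2::nat) ^ p"
proof -
  obtain x where "case x of (p, m) \<Rightarrow> t = 2 ^ p + m \<and> 0 < m \<and> m \<le> (2::nat) ^ p"
    using ex1_implies_ex[OF ex1_pm[OF assms]] by blast
  then show thesis by (cases x) (auto intro: that)
qed

lemma B_set_kernel:
  assumes "w \<in> B_set t"
  shows "w \<in> LamV t 3" "D_op w = 0"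
proof -
  obtain p m k where *: "w = B_form t p m k" "t = 2 ^ p + m" "m \<le> 2 ^ p" "2 \<le> k" "k \<le> m"
    using assms unfolding B_set_def by blast
  show "w \<in> LamV t 3" unfolding *(1) by (rule B_form_LamV[OF *(2,4,5,3)])
  have "2 * k \<le> t" using * by linarith
  then show "D_op w = 0" unfolding *(1) by (rule D_B_form[OF *(4)])
qed

lemma LamV_3_small:
  assumes "w \<in> LamV n 3" "n < 4"
  shows "w = 0"
proof -
  have "A \<notin> Poly_Mapping.keys w" for A
  proof
    assume "A \<in> Poly_Mapping.keys w"
    note A = LamV_keysD[OF assms(1) this]
    have "card A \<le> card {2..n}" by (rule card_mono[OF _ A(1)]) simp
    then show False using A(2) assms(2) by simp
  qed
  then have "Poly_Mapping.keys w = {}" by blast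
  then show ?thesis by simp
qed

text \<open>Induction on the largest index: adding the forms of \<open>B_set (Suc n)\<close>
  selected by the pivots clears the pivots with \<open>k \<le> m\<close>, and those with
  \<open>k > m\<close> vanish on the whole kernel. Then no monomial with index \<open>Suc n\<close>
  is left.\<close>

lemma kernel_spanned:
  assumes "w \<in> LamV n 3" "D_op w = 0"
  shows "w \<in> subset_sums (\<Union>t\<in>{4..n}. B_set t)"
  using assms
proof (induction n arbitrary: w)
  case 0
  then have "w = 0" by (intro LamV_3_small) auto
  then show ?case by (simp add: subset_sums_zero)
next
  case (Suc n)
  show ?case
  proof (cases "Suc n < 4")
    case True
    then have "w = 0" by (rule LamV_3_small[OF Suc.prems(1)])
    then show ?thesis by (simp add: subset_sums_zero)
  next
    case False
    obtain p m where pm: "Suc n = 2 ^ p + m" "0 < m" "m \<le> 2 ^ p"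
      using obtain_pm[of "Suc n"] False by auto
    let ?B = "B_form (Suc n) p m"
    define S where "S = {k\<in>{2..m}. coef w {k, Suc k, Suc n} = 1}"
    have finite_S: "finite S" by (simp add: S_def)
    define w' where "w' = w + (\<Sum>k\<in>S. ?B k)"
    have B_mem: "?B k \<in> B_set (Suc n)" if "k \<in> S" for k
      unfolding B_set_eq[OF pm] using that by (simp add: S_def)
    note B = B_set_kernel[OF B_mem]
    have w': "w' \<in> LamV (Suc n) 3" "D_op w' = 0"
      using Suc.prems B unfolding w'_def D_add D_sum by (simp_all add: LamV_add LamV_sum)
    have "coef w' {k, Suc k, Suc n} = 0" if k: "2 \<le> k" "Suc k < Suc n" for k
    proof (cases "k \<le> m")
      case True
      have "coef (\<Sum>k\<in>S. ?B k) {k, Suc k, Suc n} = (\<Sum>j\<in>S. of_bool (k = j))"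
        unfolding coef_sum
      proof (rule sum.cong[OF refl])
        fix j assume "j \<in> S"
        then have j: "2 \<le> j" "j \<le> m" by (simp_all add: S_def)
        show "coef (?B j) {k, Suc k, Suc n} = of_bool (k = j)"
          by (rule coef_B_form_pivot[OF pm(1) j pm(3) k])
      qed
      also have "\<dots> = of_bool (k \<in> S)"
        using finite_S by (simp add: of_bool_def sum.delta')
      also have "k \<in> S \<longleftrightarrow> coef w {k, Suc k, Suc n} = 1"
        using k True by (simp add: S_def)
      also have "of_bool (coef w {k, Suc k, Suc n} = 1) = coef w {k, Suc k, Suc n}"
        by (cases "coef w {k, Suc k, Suc n}") simp_all
      finally show ?thesis unfolding w'_def lookup_add by simp
    next
      case False
      then show ?thesis
        using coef_kernel_pivot_eq_0[OF w' pm(1,2)] k by simp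
    qed
    note pivots = this
    have "w' \<in> LamV n 3"
    proof (rule LamV_pred[OF w'(1)])
      fix a b assume "2 \<le> a" "a < b" "b < Suc n"
      with pivots show "coef w' {a, b, Suc n} = 0" by - (rule coef_kernel_zero[OF w'], blast+)
    qed
    from Suc.IH[OF this w'(2)] have "w' \<in> subset_sums (\<Union>t\<in>{4..Suc n}. B_set t)"
      by (rule subsetD[OF subset_sums_mono, rotated]) (rule UN_mono, auto)
    moreover have "?B k \<in> (\<Union>t\<in>{4..Suc n}. B_set t)" if "k \<in> S" for k
      using B_mem[OF that] False by (intro UN_I[of "Suc n"]) auto
    then have "(\<Sum>k\<in>S. ?B k) \<in> subset_sums (\<Union>t\<in>{4..Suc n}. B_set t)"
      by (intro subset_sums_sum subset_sums_mem)
    ultimately have "w' + (\<Sum>k\<in>S. ?B k) \<in> subset_sums (\<Union>t\<in>{4..Suc n}. B_set t)"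
      by (rule subset_sums_add)
    moreover have "w' + (\<Sum>k\<in>S. ?B k) = w"
      unfolding w'_def using form_cancel[of "\<Sum>k\<in>S. ?B k" w] by (simp only: ac_simps)
    ultimately show ?thesis by simp
  qed
qed

text \<open>For the largest \<open>t\<close> that occurs, the pivot of one of its forms is zero on
  all other members of \<open>X\<close>: forms from smaller \<open>t\<close> lack the index
  \<open>t\<close>.\<close>

lemma B_sets_independent:
  assumes X: "X \<subseteq> (\<Union>t\<in>{4..n}. B_set t)" "\<Sum>X = 0"
    and fin: "finite X"
  shows "X = {}"
proof (rule ccontr)
  assume "X \<noteq> {}"
  define T where "T = {t\<in>{4..n}. X \<inter> B_set t \<noteq> {}}"
  obtain x t where "x \<in> X" "t \<in> {4..n}" "x \<in> B_set t" using X(1) \<open>X \<noteq> {}\<close> by blast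
  then have "t \<in> T" unfolding T_def by blast
  then have T: "finite T" "T \<noteq> {}" unfolding T_def by auto
  define t where "t = Max T"
  have t: "t \<in> T" "\<And>t'. t' \<in> T \<Longrightarrow> t' \<le> t" using T by (auto simp: t_def)
  then have t4: "4 \<le> t" by (simp add: T_def)
  obtain p m where pm: "t = 2 ^ p + m" "0 < m" "m \<le> 2 ^ p"
    using obtain_pm[of t] t4 by auto
  obtain k where k: "2 \<le> k" "k \<le> m" "B_form t p m k \<in> X"
    using t(1) B_set_eq[OF pm] unfolding T_def by auto
  have kt: "Suc k < t" using k pm t4 by linarith
  have pivot: "coef (B_form t p m k) {k, Suc k, t} = 1"
    using coef_B_form_pivot[OF pm(1) k(1,2) pm(3) k(1) kt] by simp
  have "coef x {k, Suc k, t} = of_bool (x = B_form t p m k)" if x: "x \<in> X" for x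
  proof -
    obtain t' where t': "t' \<in> {4..n}" "x \<in> B_set t'" using x X by blast
    then have "t' \<le> t" using t(2) x by (auto simp: T_def)
    show ?thesis
    proof (cases "t' = t")
      case True
      then obtain j where j: "2 \<le> j" "j \<le> m" "x = B_form t p m j"
        using t'(2) B_set_eq[OF pm] by auto
      have x_eq: "coef x {k, Suc k, t} = of_bool (k = j)"
        unfolding j(3) by (rule coef_B_form_pivot[OF pm(1) j(1,2) pm(3) k(1) kt])
      \<comment> \<open>A form does not carry its parameter; the pivot shows that equal forms have
        equal parameters.\<close>
      have "k = j \<longleftrightarrow> x = B_form t p m k"
        using x_eq pivot j(3) by (metis of_bool_eq(1) zero_neq_one)
      then show ?thesis unfolding x_eq by simp
    next
      case False
      have x_eq: "coef x {k, Suc k, t} = 0"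
        by (rule coef_LamV_eq_0[OF B_set_kernel(1)[OF t'(2)]]) (use False \<open>t' \<le> t\<close> in auto)
      then have "x \<noteq> B_form t p m k" using pivot by (metis zero_neq_one)
      then show ?thesis unfolding x_eq by simp
    qed
  qed
  then have "coef (\<Sum>X) {k, Suc k, t} = (\<Sum>x\<in>X. of_bool (x = B_form t p m k))"
    unfolding coef_sum by (intro sum.cong refl)
  also have "\<dots> = 1"
    using fin k(3) by (simp add: of_bool_def sum.delta)
  finally show False using X(2) by simp
qed

section \<open>The cohomology\<close>

lemma Lam_split:
  assumes "w \<in> Lam n q"
  obtains w0 w1 where "w = w0 + w1" "w0 \<in> LamV n q" "w1 \<in> Lam n q" "\<And>A. A \<in> Poly_Mapping.keys w1 \<Longrightarrow> 1 \<in> A"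
proof -
  have "\<exists>w0 w1. w = w0 + w1 \<and> w0 \<in> LamV n q \<and> w1 \<in> Lam n q \<and> (\<forall>A\<in>Poly_Mapping.keys w1. 1 \<in> A)"
  proof (rule form_cases_sum[of w])
    fix A assume "A \<in> Poly_Mapping.keys w"
    then have A: "A \<subseteq> {1..n}" "card A = q" using assms by (auto simp: Lam_def)
    show "\<exists>w0 w1. mon A = w0 + w1 \<and> w0 \<in> LamV n q \<and> w1 \<in> Lam n q \<and> (\<forall>A\<in>Poly_Mapping.keys w1. 1 \<in> A)"
    proof (cases "1 \<in> A")
      case True
      then show ?thesis using A by (intro exI[of _ 0] exI[of _ "mon A"]) (simp add: Lam_def)
    next
      case False
      have "A \<subseteq> {2..n}"
      proof
        fix x assume "x \<in> A"
        then have "1 \<le> x" "x \<le> n" "x \<noteq> 1" using A False by auto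
        then show "x \<in> {2..n}" by simp
      qed
      then show ?thesis using A by (intro exI[of _ "mon A"] exI[of _ 0]) (simp add: LamV_mon Lam_zero)
    qed
  next
    show "\<exists>w0 w1. 0 = w0 + w1 \<and> w0 \<in> LamV n q \<and> w1 \<in> Lam n q \<and> (\<forall>A\<in>Poly_Mapping.keys w1. 1 \<in> A)"
      by (intro exI[of _ 0]) (simp add: Lam_zero)
  next
    fix u v
    assume "\<exists>w0 w1. u = w0 + w1 \<and> w0 \<in> LamV n q \<and> w1 \<in> Lam n q \<and> (\<forall>A\<in>Poly_Mapping.keys w1. 1 \<in> A)"
      and "\<exists>w0 w1. v = w0 + w1 \<and> w0 \<in> LamV n q \<and> w1 \<in> Lam n q \<and> (\<forall>A\<in>Poly_Mapping.keys w1. 1 \<in> A)"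
    then obtain u0 u1 v0 v1 where
      u: "u = u0 + u1" "u0 \<in> LamV n q" "u1 \<in> Lam n q" "\<forall>A\<in>Poly_Mapping.keys u1. 1 \<in> A" and
      v: "v = v0 + v1" "v0 \<in> LamV n q" "v1 \<in> Lam n q" "\<forall>A\<in>Poly_Mapping.keys v1. 1 \<in> A" by blast
    have "u + v = (u0 + v0) + (u1 + v1)" unfolding u(1) v(1) by (simp only: ac_simps)
    moreover have "\<forall>A\<in>Poly_Mapping.keys (u1 + v1). 1 \<in> A"
      using u(4) v(4) Poly_Mapping.keys_add[of u1 v1] by blast
    ultimately show "\<exists>w0 w1. u + v = w0 + w1 \<and> w0 \<in> LamV n q \<and> w1 \<in> Lam n q \<and> (\<forall>A\<in>Poly_Mapping.keys w1. 1 \<in> A)"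
      using LamV_add[OF u(2) v(2)] Lam_add[OF u(3) v(3)] by blast
  qed
  then show thesis using that by blast
qed

lemma d_op_eq_0_if_one:
  assumes "\<And>A. A \<in> Poly_Mapping.keys w \<Longrightarrow> 1 \<in> A"
  shows "d_op w = 0"
  by (rule form_cases_sum[of w]) (use assms in \<open>auto simp: d_mon d_op_add simp del: One_nat_def\<close>)

lemma d_op_LamV: "w \<in> LamV n q \<Longrightarrow> d_op w = D_op w \<and>\<^sub>f mon {1}"
  using d_eq_wedge_D[of w] LamV_keysD(1)[of w n q]
  by (fastforce simp: e_distinct wedge_commute simp del: One_nat_def)

text \<open>Monomials containing e^1 have zero differential, so the 2-forms without it yield all
  coboundaries.\<close>

lemma coboundaries_3: "coboundaries n 3 = (\<lambda>u. D_op u \<and>\<^sub>f mon {1}) ` LamV n 2"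
proof
  show "coboundaries n 3 \<subseteq> (\<lambda>u. D_op u \<and>\<^sub>f mon {1}) ` LamV n 2"
  proof
    fix b assume "b \<in> coboundaries n 3"
    then obtain w where w: "w \<in> Lam n 2" "b = d_op w" by (auto simp: coboundaries_def)
    obtain w0 w1 where *: "w = w0 + w1" "w0 \<in> LamV n 2" "\<And>A. A \<in> Poly_Mapping.keys w1 \<Longrightarrow> 1 \<in> A"
      using Lam_split[OF w(1)] by metis
    have "b = D_op w0 \<and>\<^sub>f mon {1}"
      unfolding w(2) *(1) d_op_add d_op_LamV[OF *(2)] using d_op_eq_0_if_one[OF *(3)] by simp
    then show "b \<in> (\<lambda>u. D_op u \<and>\<^sub>f mon {1}) ` LamV n 2" using *(2) by blast
  qed
  show "(\<lambda>u. D_op u \<and>\<^sub>f mon {1}) ` LamV n 2 \<subseteq> coboundaries n 3"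
  proof (rule image_subsetI)
    fix u assume u: "u \<in> LamV n 2"
    have "d_op u \<in> d_op ` Lam n 2" using LamV_Lam[OF u] by (rule imageI)
    then show "D_op u \<and>\<^sub>f mon {1} \<in> coboundaries n 3"
      unfolding d_op_LamV[OF u, symmetric] by (simp add: coboundaries_def)
  qed
qed

text \<open>The convention in \<open>e2\<close> absorbs the degenerate cases \<open>x = 2\<close>,
  where \<open>D_op\<close> kills the factor, and \<open>y - 1 = x\<close>, where an index
  repeats.\<close>

lemma D_e2:
  assumes "2 \<le> x" "x < y"
  shows "D_op (e2 x y) = e2 (x - 1) y + e2 x (y - 1)"
proof -
  have "D_op (mon {x, y}) =
      (if 2 < x \<and> x - 1 \<notin> {x, y} then mon (insert (x - 1) ({x, y} - {x})) else 0) +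
      (if 2 < y \<and> y - 1 \<notin> {x, y} then mon (insert (y - 1) ({x, y} - {y})) else 0)"
    unfolding D_mon using assms by simp
  moreover have "{x, y} - {x} = {y}" "{x, y} - {y} = {x}" using assms by auto
  moreover have "2 < x \<and> x - 1 \<notin> {x, y} \<longleftrightarrow> 2 \<le> x - 1 \<and> 2 \<le> y \<and> x - 1 \<noteq> y" using assms by auto
  moreover have "2 < y \<and> y - 1 \<notin> {x, y} \<longleftrightarrow> 2 \<le> x \<and> 2 \<le> y - 1 \<and> x \<noteq> y - 1" using assms by auto
  moreover have "e2 x y = mon {x, y}" using assms by (simp add: e2_def)
  ultimately show ?thesis
    unfolding e2_def by (simp add: insert_commute)
qed

section \<open>The cokernel of \<open>D_op\<close> on 2-forms\<close>

definition e1_gens :: "nat \<Rightarrow> form set" where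
  "e1_gens n = {e_mon [1, i - 1, i] | i. 2 + n div 2 \<le> i \<and> i \<le> n}"

lemma e_mon_1: "3 \<le> i \<Longrightarrow> e_mon [1, i - 1, i] = mon {1, i - 1, i}"
  by (subst e_distinct) auto

definition spanned_mod :: "nat \<Rightarrow> form set \<Rightarrow> form set" where
  "spanned_mod n G = {w. \<exists>g\<in>subset_sums G. w + g \<in> coboundaries n 3}"

lemma spanned_mod_add:
  assumes "u \<in> spanned_mod n G" "v \<in> spanned_mod n G"
  shows "u + v \<in> spanned_mod n G"
proof -
  obtain g h where *: "g \<in> subset_sums G" "u + g \<in> coboundaries n 3" "h \<in> subset_sums G" "v + h \<in> coboundaries n 3"
    using assms unfolding spanned_mod_def by blast
  have "(u + v) + (g + h) = (u + g) + (v + h)" by (simp only: ac_simps)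
  then have "(u + v) + (g + h) \<in> coboundaries n 3" using coboundaries_add[OF *(2,4)] by (simp only:)
  then show ?thesis using subset_sums_add[OF *(1,3)] unfolding spanned_mod_def by blast
qed

lemma spanned_mod_subset_sums: "w \<in> subset_sums G \<Longrightarrow> w \<in> spanned_mod n G"
  unfolding spanned_mod_def by (intro CollectI bexI[of _ w]) (simp_all add: form_double coboundaries_zero)

lemma spanned_mod_coboundary: "w \<in> coboundaries n 3 \<Longrightarrow> w \<in> spanned_mod n G"
  unfolding spanned_mod_def using subset_sums_zero by force

lemma D_e2_coboundary:
  assumes "2 \<le> x" "x < y" "y \<le> n"
  shows "e2 (x - 1) y \<and>\<^sub>f mon {1} + e2 x (y - 1) \<and>\<^sub>f mon {1} \<in> coboundaries n 3"
proof -
  have "e2 x y \<in> LamV n 2" using assms by (intro LamV_e2) auto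
  then have "D_op (e2 x y) \<and>\<^sub>f mon {1} \<in> coboundaries n 3" unfolding coboundaries_3 by blast
  then show ?thesis unfolding D_e2[OF assms(1,2)] wedge_add_left .
qed

text \<open>The pair moves outwards until \<open>x = 2\<close>, where the next step gives zero;
  \<open>x + y \<le> Suc n\<close> keeps the upper index within \<open>n\<close>.\<close>

lemma e1_e2_coboundary:
  assumes "2 \<le> x" "x < y" "x + y \<le> Suc n"
  shows "e2 x y \<and>\<^sub>f mon {1} \<in> coboundaries n 3"
  using assms
proof (induction "x - 2" arbitrary: x y)
  case 0
  then have "x = 2" by simp
  then show ?case
    using D_e2_coboundary[of 2 "Suc y" n] 0 by (simp add: e2_def)
next
  case (Suc d)
  have "e2 (x - 1) (Suc y) \<and>\<^sub>f mon {1} + e2 x y \<and>\<^sub>f mon {1} \<in> coboundaries n 3"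
    using D_e2_coboundary[of x "Suc y" n] Suc by simp
  moreover have "e2 (x - 1) (Suc y) \<and>\<^sub>f mon {1} \<in> coboundaries n 3"
    using Suc by (intro Suc.hyps) auto
  ultimately show ?case using coboundaries_add form_cancel by metis
qed

lemma e2_e1: "2 \<le> x \<Longrightarrow> x < y \<Longrightarrow> e2 x y \<and>\<^sub>f mon {1} = mon {1, x, y}"
  by (auto simp: e2_def wedge_mon insert_commute)

text \<open>The pair moves inwards and ends at zero or at a consecutive pair. The latter gives a
  generator if \<open>2 + n div 2 \<le> y\<close>; otherwise its weight is at most
  \<open>Suc n\<close> and it gives a coboundary.\<close>

lemma e1_spanned:
  assumes "2 \<le> x" "x < y" "y \<le> n"
  shows "e2 x y \<and>\<^sub>f mon {1} \<in> spanned_mod n (e1_gens n)"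
  using assms
proof (induction "y - x" arbitrary: x y rule: less_induct)
  case less
  show ?case
  proof (cases "y = Suc x")
    case True
    show ?thesis
    proof (cases "2 + n div 2 \<le> y")
      case y: True
      have "e2 x y \<and>\<^sub>f mon {1} = e_mon [1, y - 1, y]"
        unfolding e2_e1[OF less.prems(1,2)] using e_mon_1[of y] True less.prems by simp
      then have "e2 x y \<and>\<^sub>f mon {1} \<in> e1_gens n"
        unfolding e1_gens_def using y less.prems by blast
      then show ?thesis by (intro spanned_mod_subset_sums subset_sums_mem)
    next
      case False
      then show ?thesis
        using True less.prems by (intro spanned_mod_coboundary e1_e2_coboundary) linarith+
    qed
  next
    case False
    have "e2 x y \<and>\<^sub>f mon {1} + e2 (Suc x) (y - 1) \<and>\<^sub>f mon {1} \<in> coboundaries n 3"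
      using D_e2_coboundary[of "Suc x" y n] less.prems False by simp
    then have 1: "e2 x y \<and>\<^sub>f mon {1} + e2 (Suc x) (y - 1) \<and>\<^sub>f mon {1} \<in> spanned_mod n (e1_gens n)"
      by (rule spanned_mod_coboundary)
    have 2: "e2 (Suc x) (y - 1) \<and>\<^sub>f mon {1} \<in> spanned_mod n (e1_gens n)"
    proof (cases "Suc x = y - 1")
      case True
      then have "e2 (Suc x) (y - 1) \<and>\<^sub>f mon {1} = 0" by (simp add: e2_def)
      then show ?thesis using spanned_mod_coboundary[OF coboundaries_zero] by simp
    next
      case neq: False
      then show ?thesis using less.prems False by (intro less.hyps) auto
    qed
    from spanned_mod_add[OF 1 2] show ?thesis
      by (simp add: add.assoc form_double)
  qed
qed

lemma one_part_spanned:
  assumes "w \<in> Lam n 3" "\<And>A. A \<in> Poly_Mapping.keys w \<Longrightarrow> 1 \<in> A"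
  shows "w \<in> spanned_mod n (e1_gens n)"
proof (rule form_cases_sum[of w])
  fix A assume A: "A \<in> Poly_Mapping.keys w"
  then have "A \<subseteq> {1..n}" "card A = 3" "1 \<in> A" using assms by (auto simp: Lam_def)
  obtain a b c where abc: "a < b" "b < c" "A = {a, b, c}" using card_3_nat_cases[OF \<open>card A = 3\<close>] .
  have "a = 1" using \<open>1 \<in> A\<close> \<open>A \<subseteq> {1..n}\<close> abc by auto
  then have bc: "2 \<le> b" "b < c" "c \<le> n" using abc \<open>A \<subseteq> {1..n}\<close> by auto
  have "mon A = e2 b c \<and>\<^sub>f mon {1}" unfolding e2_e1[OF bc(1,2)] abc(3) \<open>a = 1\<close> ..
  then show "mon A \<in> spanned_mod n (e1_gens n)" using e1_spanned[OF bc] by (simp only:)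
qed (use spanned_mod_coboundary[OF coboundaries_zero] spanned_mod_add in auto)

text \<open>The sum over \<open>v\<close> telescopes on coboundaries; the boundary terms vanish because
  \<open>2 * k\<close> exceeds \<open>n\<close>.\<close>

lemma sum_coef_coboundary:
  assumes "b \<in> coboundaries n 3" "n < 2 * k" "2 \<le> k"
  shows "(\<Sum>v = 2..k. coef b {1, v, 2 * k + 1 - v}) = 0"
proof -
  obtain u where u: "u \<in> LamV n 2" "b = D_op u \<and>\<^sub>f mon {1}"
    using assms(1) unfolding coboundaries_3 by blast
  let ?h = "\<lambda>v. coef u {v, 2 * k + 2 - v}"
  have "(\<Sum>v = 2..k. coef b {1, v, 2 * k + 1 - v}) = (\<Sum>v = 2..k. ?h (Suc v) - ?h v)"
  proof (rule sum.cong[OF refl])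
    fix v assume v: "v \<in> {2..k}"
    have "{1, v, 2 * k + 1 - v} - {1} = {v, 2 * k + 1 - v}" using v by auto
    then have "coef b {1, v, 2 * k + 1 - v} = coef (D_op u) {v, 2 * k + 1 - v}"
      unfolding u(2) coef_wedge_generator by simp
    also have "\<dots> = coef u {Suc v, 2 * k + 1 - v} + coef u {v, Suc (2 * k + 1 - v)}"
      using v by (intro coef_D2[OF LamV_homog[OF u(1)]]) auto
    also have "Suc (2 * k + 1 - v) = 2 * k + 2 - v" using v by auto
    also have "2 * k + 1 - v = 2 * k + 2 - Suc v" by simp
    finally show "coef b {1, v, 2 * k + 1 - v} = ?h (Suc v) - ?h v" by simp
  qed
  also have "\<dots> = ?h (Suc k) - ?h 2"
    using assms(3) by (intro sum_Suc_diff) simp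
  also have "?h (Suc k) = 0"
    by (rule coef_homog_eq_0[OF LamV_homog[OF u(1)]]) simp
  also have "?h 2 = 0"
    by (rule coef_LamV_eq_0[OF u(1)]) (use assms in auto)
  finally show ?thesis by simp
qed

text \<open>The functional of \<open>sum_coef_coboundary\<close> for \<open>k = i - 1\<close>
  vanishes on coboundaries, is 1 at the generator with index \<open>i\<close>, and is 0 at the
  others, whose weights differ.\<close>

lemma e1_gens_independent:
  assumes X: "X \<subseteq> e1_gens n" "\<Sum>X \<in> coboundaries n 3" "finite X" and n: "4 \<le> n"
  shows "X = {}"
proof (rule ccontr)
  assume "X \<noteq> {}"
  then obtain x where "x \<in> X" by blast
  then obtain i where i: "2 + n div 2 \<le> i" "x = e_mon [1, i - 1, i]"
    using X(1) unfolding e1_gens_def by blast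
  define k where "k = i - 1"
  have k: "2 \<le> k" "n < 2 * k" using i n unfolding k_def by auto
  have xk: "x = mon {1, k, Suc k}" using i(2) e_mon_1[of i] k unfolding k_def by simp
  have "(\<Sum>v = 2..k. coef y {1, v, 2 * k + 1 - v}) = of_bool (y = x)" if y: "y \<in> X" for y
  proof -
    obtain j where j: "2 + n div 2 \<le> j" "y = e_mon [1, j - 1, j]"
      using y X(1) unfolding e1_gens_def by blast
    define l where "l = j - 1"
    have l: "2 \<le> l" using j n unfolding l_def by auto
    have yl: "y = mon {1, l, Suc l}" using j(2) e_mon_1[of j] l unfolding l_def by simp
    have set_eq: "{1, l, Suc l} = {1, v, 2 * k + 1 - v} \<longleftrightarrow> v = k \<and> l = k" if "v \<in> {2..k}" for v
    proof
      assume eq: "{1, l, Suc l} = {1, v, 2 * k + 1 - v}"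
      have "{1, l, Suc l} - {1} = {l, Suc l}" "{1, v, 2 * k + 1 - v} - {1} = {v, 2 * k + 1 - v}"
        using l that by auto
      then have "{l, Suc l} = {v, 2 * k + 1 - v}" unfolding eq by (simp only:)
      then consider "l = v" "Suc l = 2 * k + 1 - v" | "l = 2 * k + 1 - v" "Suc l = v"
        by (auto simp: doubleton_eq_iff)
      moreover have "v \<le> k" using that by simp
      ultimately show "v = k \<and> l = k" by cases linarith+
    next
      assume "v = k \<and> l = k"
      then show "{1, l, Suc l} = {1, v, 2 * k + 1 - v}" by auto
    qed
    have "(\<Sum>v = 2..k. coef y {1, v, 2 * k + 1 - v}) = (\<Sum>v = 2..k. if v = k then of_bool (l = k) else 0)"
      unfolding yl coef_mon
    proof (rule sum.cong[OF refl])
      fix v assume "v \<in> {2..k}"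
      then show "of_bool ({1, l, Suc l} = {1, v, 2 * k + 1 - v}) = (if v = k then of_bool (l = k) else (0::bit))"
        by (simp only: set_eq) simp
    qed
    also have "\<dots> = of_bool (l = k)" using k by (simp add: sum.delta)
    also have "l = k \<longleftrightarrow> y = x"
    proof
      assume "y = x"
      then have "coef (mon {1, l, Suc l}) {1, k, Suc k} = 1" unfolding yl xk by (simp add: coef_mon)
      then have "{1, l, Suc l} = {1, k, 2 * k + 1 - k}" by (simp add: coef_mon split: if_splits)
      then show "l = k" using set_eq[of k] k by simp
    qed (simp add: yl xk)
    finally show ?thesis .
  qed
  note single = this
  have "(\<Sum>v = 2..k. coef (\<Sum>X) {1, v, 2 * k + 1 - v}) = (\<Sum>y\<in>X. \<Sum>v = 2..k. coef y {1, v, 2 * k + 1 - v})"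
    unfolding coef_sum by (rule sum.swap)
  also have "\<dots> = (\<Sum>y\<in>X. of_bool (y = x))"
    by (rule sum.cong[OF refl]) (rule single)
  also have "\<dots> = 1"
    using X(3) \<open>x \<in> X\<close> by (simp add: of_bool_def sum.delta)
  finally show False
    using sum_coef_coboundary[OF X(2) k(2,1)] by simp
qed

text \<open>Over the two-element field a linear combination is a subset sum.\<close>

lemma coef_LamV_one: "w \<in> LamV n q \<Longrightarrow> 1 \<in> A \<Longrightarrow> coef w A = 0"
  by (rule coef_LamV_eq_0) auto

text \<open>Reduces the claim on classes to subset sums of representatives. Applied to two-element
  sets, \<open>indep\<close> also yields injectivity.\<close>

lemma cohomology_basisI:
  assumes G: "finite G" "G \<subseteq> cocycles n q"
    and indep: "\<And>X. X \<subseteq> G \<Longrightarrow> \<Sum>X \<in> coboundaries n q \<Longrightarrow> X = {}"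
    and span: "\<And>z. z \<in> cocycles n q \<Longrightarrow> \<exists>X\<subseteq>G. z + \<Sum>X \<in> coboundaries n q"
  shows "inj_on (coh_class n q) G" "vectorspace.basis class_ring (cohomology n q) (coh_class n q ` G)"
proof -
  let ?V = "cohomology n q" and ?c = "coh_class n q"
  interpret V: vectorspace class_ring ?V by (rule cohomology_vectorspace)
  have carrierI: "?c v \<in> carrier ?V" if "v \<in> cocycles n q" for v
    using that by (simp add: cohomology_carrier)
  show inj: "inj_on ?c G"
  proof (rule inj_onI, rule ccontr)
    fix v w assume vw: "v \<in> G" "w \<in> G" "?c v = ?c w" "v \<noteq> w"
    then have "\<Sum>{v, w} \<in> coboundaries n q" by (simp add: coh_class_eq_iff)
    then show False using indep[of "{v, w}"] vw by simp
  qed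
  \<comment> \<open>By injectivity, coefficients attached to classes are coefficients attached to
    representatives.\<close>
  have lincomb: "V.lincomb a (?c ` G) = ?c (\<Sum>g\<in>G. scale (a (?c g)) g)" for a
  proof -
    have "(\<Oplus>\<^bsub>?V\<^esub>v\<in>?c ` H. a v \<odot>\<^bsub>?V\<^esub> v) = ?c (\<Sum>g\<in>H. scale (a (?c g)) g)" if "H \<subseteq> G" for H
      using finite_subset[OF that G(1)] that
    proof (induction H rule: finite_induct)
      case empty
      show ?case by (simp add: cohomology_zero)
    next
      case (insert h H)
      have notin: "?c h \<notin> ?c ` H"
        using insert inj by (auto dest: inj_onD)
      have smult: "a (?c g) \<odot>\<^bsub>?V\<^esub> ?c g \<in> carrier ?V" if "g \<in> insert h H" for g
        unfolding cohomology_smult using that insert.prems G(2) by (intro carrierI cocycles_scale) blast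
      have IH: "(\<Oplus>\<^bsub>?V\<^esub>v\<in>?c ` H. a v \<odot>\<^bsub>?V\<^esub> v) = ?c (\<Sum>g\<in>H. scale (a (?c g)) g)"
        using insert.IH insert.prems by simp
      have "(\<Oplus>\<^bsub>?V\<^esub>v\<in>insert (?c h) (?c ` H). a v \<odot>\<^bsub>?V\<^esub> v) =
        a (?c h) \<odot>\<^bsub>?V\<^esub> ?c h \<oplus>\<^bsub>?V\<^esub> (\<Oplus>\<^bsub>?V\<^esub>v\<in>?c ` H. a v \<odot>\<^bsub>?V\<^esub> v)"
        using notin smult insert.hyps(1) by (intro V.finsum_insert) auto
      then show ?case
        unfolding image_insert IH cohomology_smult cohomology_add using insert.hyps by simp
    qed
    then show ?thesis unfolding V.lincomb_def by blast
  qed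
  have scale_sum: "(\<Sum>g\<in>G. scale (b g) g) = \<Sum>{g\<in>G. b g = 1}" for b
  proof -
    have "(\<Sum>g\<in>G. scale (b g) g) = (\<Sum>g\<in>G. if b g = 1 then g else 0)"
    proof (rule sum.cong[OF refl])
      fix g show "scale (b g) g = (if b g = 1 then g else 0)" by (cases "b g") simp_all
    qed
    then show ?thesis by (simp only: sum.inter_filter[OF G(1)])
  qed
  have sub: "?c ` G \<subseteq> carrier ?V" using G(2) carrierI by blast
  have "V.lin_indpt (?c ` G)"
  proof (rule V.finite_lin_indpt2)
    fix a assume "V.lincomb a (?c ` G) = \<zero>\<^bsub>?V\<^esub>"
    then have "\<Sum>{g\<in>G. a (?c g) = 1} \<in> coboundaries n q"
      unfolding lincomb scale_sum cohomology_zero coh_class_eq_iff by simp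
    then have "{g\<in>G. a (?c g) = 1} = {}" by (intro indep) auto
    then show "\<forall>v\<in>?c ` G. a v = \<zero>\<^bsub>class_ring\<^esub>"
      by auto
  qed (use G sub in auto)
  moreover have "V.span (?c ` G) = carrier ?V"
  proof
    show "V.span (?c ` G) \<subseteq> carrier ?V" using sub V.span_is_subset2 by blast
    show "carrier ?V \<subseteq> V.span (?c ` G)"
    proof
      fix x assume "x \<in> carrier ?V"
      then obtain z where z: "z \<in> cocycles n q" "x = ?c z" by (auto simp: cohomology_carrier)
      obtain X where X: "X \<subseteq> G" "z + \<Sum>X \<in> coboundaries n q" using span[OF z(1)] by blast
      define a :: "form set \<Rightarrow> bit" where "a v = of_bool (v \<in> ?c ` X)" for v
      have "{g\<in>G. a (?c g) = 1} = X"
        using X(1) inj unfolding a_def by (auto dest: inj_onD)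
      then have "V.lincomb a (?c ` G) = ?c (\<Sum>X)" unfolding lincomb scale_sum by simp
      also have "\<dots> = x" using X(2) unfolding z(2) by (simp add: coh_class_eq_iff add.commute)
      finally show "x \<in> V.span (?c ` G)"
        using V.finite_span[OF finite_imageI[OF G(1)] sub] by auto
    qed
  qed
  ultimately show "V.basis (?c ` G)"
    unfolding V.basis_def using sub by auto
qed

section \<open>The generating set of the theorem\<close>

lemma generators_eq: "generators n = e1_gens n \<union> (\<Union>t\<in>{4..n}. B_set t)"
  unfolding generators_def e1_gens_def ..

lemma finite_B_set: "2 \<le> t \<Longrightarrow> finite (B_set t)"
  using obtain_pm[of t] B_set_eq by (metis finite_atLeastAtMost finite_imageI)

lemma finite_generators: "finite (generators n)"
proof -
  have "e1_gens n \<subseteq> (\<lambda>i. e_mon [1, i - 1, i]) ` {..n}" unfolding e1_gens_def by auto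
  then have "finite (e1_gens n)" by (rule finite_subset) simp
  then show ?thesis unfolding generators_eq by (simp add: finite_B_set)
qed

lemma e1_gens_cocycle:
  assumes "x \<in> e1_gens n" "4 \<le> n"
  shows "x \<in> cocycles n 3" "\<And>A. A \<in> Poly_Mapping.keys x \<Longrightarrow> 1 \<in> A"
proof -
  obtain i where i: "2 + n div 2 \<le> i" "i \<le> n" "x = e_mon [1, i - 1, i]"
    using assms(1) unfolding e1_gens_def by blast
  then have i3: "3 \<le> i" using assms(2) by linarith
  then have x: "x = mon {1, i - 1, i}" using i(3) e_mon_1 by simp
  then show one: "1 \<in> A" if "A \<in> Poly_Mapping.keys x" for A
    using that by simp
  have "card {1, i - 1, i} = 3" using i3 by simp
  then have "x \<in> Lam n 3" unfolding x Lam_def using i(2) i3 by auto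
  then show "x \<in> cocycles n 3" unfolding cocycles_def using d_op_eq_0_if_one[OF one] by simp
qed

lemma generators_cocycles:
  assumes "4 \<le> n"
  shows "generators n \<subseteq> cocycles n 3"
proof
  fix x assume "x \<in> generators n"
  then consider "x \<in> e1_gens n" | t where "t \<in> {4..n}" "x \<in> B_set t"
    unfolding generators_eq by blast
  then show "x \<in> cocycles n 3"
  proof cases
    case 2
    then have "x \<in> LamV n 3" using LamV_mono[OF _ B_set_kernel(1)] by auto
    then show ?thesis
      unfolding cocycles_def using LamV_Lam d_op_LamV B_set_kernel(2)[OF 2(2)] by simp
  qed (use e1_gens_cocycle assms in blast)
qed

theorem theorem4:
  fixes n :: nat
  assumes "n \<ge> 4"
  shows "(\<forall>t\<ge>4. B_set t \<subseteq> Lam t 3)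
    \<and> generators n \<subseteq> cocycles n 3
    \<and> inj_on (coh_class n 3) (generators n)
    \<and> vectorspace.basis class_ring (cohomology n 3) (coh_class n 3 ` generators n)"
proof -
  let ?B = "\<Union>t\<in>{4..n}. B_set t"
  have B: "x \<in> LamV n 3" if "x \<in> ?B" for x
    using that LamV_mono[OF _ B_set_kernel(1)] by auto
  have indep: "X = {}" if X: "X \<subseteq> generators n" "\<Sum>X \<in> coboundaries n 3" for X
  proof -
    have fin: "finite X" using X(1) finite_generators finite_subset by blast
    have XB: "X - e1_gens n \<subseteq> ?B" using X(1) unfolding generators_eq by blast
    have split: "\<Sum>X = \<Sum>(X \<inter> e1_gens n) + \<Sum>(X - e1_gens n)"
      using sum.Int_Diff[OF fin, of "\<lambda>x. x"] .
    obtain u where u: "\<Sum>X = D_op u \<and>\<^sub>f mon {1}" using X(2) unfolding coboundaries_3 by blast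
    \<comment> \<open>Coboundaries and \<open>e1_gens n\<close> involve only monomials with index 1,
      the forms in \<open>?B\<close> only monomials without it. Hence this part is zero exactly, not
      just up to coboundaries.\<close>
    have "\<Sum>(X - e1_gens n) = 0"
    proof (rule poly_mapping_eqI)
      fix A
      show "coef (\<Sum>(X - e1_gens n)) A = coef 0 A"
      proof (cases "1 \<in> A")
        case True
        have "\<Sum>(X - e1_gens n) \<in> LamV n 3" using XB B by (intro LamV_sum) blast
        then show ?thesis using coef_LamV_one[OF _ True] by simp
      next
        case False
        have "coef x A = 0" if "x \<in> e1_gens n" for x
          using e1_gens_cocycle(2)[OF that assms, of A] False unfolding in_keys_iff by blast
        then have "coef (\<Sum>(X \<inter> e1_gens n)) A = 0" unfolding coef_sum by (intro sum.neutral) simp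
        moreover have "coef (\<Sum>X) A = 0" unfolding u coef_wedge_generator using False by simp
        ultimately show ?thesis using split by (simp add: lookup_add)
      qed
    qed
    then have "X - e1_gens n = {}"
      using XB fin by (intro B_sets_independent) auto
    then have "X \<subseteq> e1_gens n" by blast
    then show ?thesis using X(2) fin assms by (rule e1_gens_independent)
  qed
  have span: "\<exists>X\<subseteq>generators n. z + \<Sum>X \<in> coboundaries n 3" if z: "z \<in> cocycles n 3" for z
  proof -
    obtain z0 z1 where *: "z = z0 + z1" "z0 \<in> LamV n 3" "z1 \<in> Lam n 3" "\<And>A. A \<in> Poly_Mapping.keys z1 \<Longrightarrow> 1 \<in> A"
      by (rule Lam_split[of z n 3]) (use z in \<open>simp_all add: cocycles_def\<close>)
    have "d_op z = 0" using z by (simp add: cocycles_def)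
    then have d0: "D_op z0 \<and>\<^sub>f mon {1} = 0"
      unfolding *(1) d_op_add d_op_LamV[OF *(2)] using d_op_eq_0_if_one[OF *(4)] by simp
    \<comment> \<open>The wedge with e^1 is injective on forms without index 1: the coefficient at
      \<open>A\<close> reappears at \<open>insert 1 A\<close>.\<close>
    have "D_op z0 = 0"
    proof (rule poly_mapping_eqI)
      fix A
      show "coef (D_op z0) A = coef 0 A"
      proof (cases "1 \<in> A")
        case True
        then show ?thesis using coef_LamV_one[OF LamV_D[OF *(2)]] by simp
      next
        case False
        have "coef (D_op z0 \<and>\<^sub>f mon {1}) (insert 1 A) = coef (D_op z0) A"
          unfolding coef_wedge_generator using False by simp
        then show ?thesis using d0 by simp
      qed
    qed
    then have "z0 \<in> subset_sums ?B" by (rule kernel_spanned[OF *(2)])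
    then have z0: "z0 \<in> subset_sums (generators n)"
      using subset_sums_mono[of ?B "generators n"] unfolding generators_eq by blast
    obtain g where g: "g \<in> subset_sums (e1_gens n)" "z1 + g \<in> coboundaries n 3"
      using one_part_spanned[OF *(3,4)] unfolding spanned_mod_def by blast
    have "g \<in> subset_sums (generators n)"
      using g(1) subset_sums_mono[of "e1_gens n" "generators n"] unfolding generators_eq by blast
    from subset_sums_add[OF z0 this] obtain X where X: "X \<subseteq> generators n" "z0 + g = \<Sum>X"
      unfolding subset_sums_def by blast
    have "z + \<Sum>X = z1 + g"
      unfolding *(1) X(2)[symmetric] using form_cancel[of z0 "z1 + g"] by (simp only: ac_simps)
    then show ?thesis using X(1) g(2) by auto
  qed
  have "B_set t \<subseteq> Lam t 3" for t
    using B_set_kernel(1) LamV_Lam by blast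
  then show ?thesis
    using generators_cocycles[OF assms]
      cohomology_basisI[OF finite_generators generators_cocycles[OF assms] indep span] by blast
qed

end
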